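(* Let $s$ be an integer with $s>5$ and $n$ an integer with $n>2$. Let $C\subset \mathbb{S}^{n-1}$ be a spherical $s$-distance $t$-design with $t\geq 2s-2$. Then $\langle x,y\rangle$ is a rational number for all $x,y\in C$.
   Context: $\mathbb{S}^{n-1}$ is the unit sphere in $\mathbb{R}^n$ with the standard inner product $\langle\cdot,\cdot\rangle$. A finite set $C\subset\mathbb{S}^{n-1}$ is a spherical $t$-design if $\frac{1}{\mu(\mathbb{S}^{n-1})}\int_{\mathbb{S}^{n-1}} f\,d\mu=\frac{1}{|C|}\sum_{x\in C}f(x)$ for every polynomial $f$ in $n$ variables of degree at most $t$, where $\mu$ is the surface measure. $C$ is $s$-distance if the set $A(C)=\{\langle x,y\rangle: x,y\in C,\ x\neq y\}$ has exactly $s$ elements. *)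

theory Defs
  imports "HOL-Analysis.Analysis"
begin

text \<open>
  Surface measure on the unit sphere, as given by polar coordinates: a Borel set \<open>A\<close> of unit
  vectors gets \<open>DIM('a)\<close> times the volume of the cone \<open>{r x | 0 < r < 1, x \<in> A}\<close>
  (see \<open>emeasure_sphere_measure\<close>). Note that \<open>sgn x = x /\<^sub>R norm x\<close>.
\<close>

definition sphere_measure :: "'a::euclidean_space measure" where
  "sphere_measure =
     scale_measure (of_nat DIM('a))
       (distr (restrict_space lborel (ball 0 1 - {0})) (restrict_space borel (sphere 0 1)) sgn)"

lemma space_sphere_measure: "space (sphere_measure :: 'a::euclidean_space measure) = sphere 0 1"
  by (simp add: sphere_measure_def space_scale_measure space_restrict_space)

lemma sets_sphere_measure:
  "sets (sphere_measure :: 'a::euclidean_space measure) = sets (restrict_space borel (sphere 0 1))"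
  by (simp add: sphere_measure_def)

lemma cone_eq_sgn_vimage:
  fixes A :: "'a::euclidean_space set"
  assumes "A \<subseteq> sphere 0 1"
  shows "{r *\<^sub>R x | r x. 0 < r \<and> r < 1 \<and> x \<in> A} = sgn -` A \<inter> (ball 0 1 - {0})"
proof (intro equalityI subsetI)
  fix y assume "y \<in> {r *\<^sub>R x | r x. 0 < r \<and> r < 1 \<and> x \<in> A}"
  then obtain r x where y: "y = r *\<^sub>R x" "0 < r" "r < 1" "x \<in> A" by auto
  with assms have "norm x = 1" by auto
  with y show "y \<in> sgn -` A \<inter> (ball 0 1 - {0})"
    by (auto simp: sgn_div_norm)
next
  fix y assume y: "y \<in> sgn -` A \<inter> (ball 0 1 - {0})"
  then have "y = norm y *\<^sub>R sgn y" "0 < norm y" "norm y < 1" "sgn y \<in> A"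
    by (auto simp: sgn_div_norm)
  then show "y \<in> {r *\<^sub>R x | r x. 0 < r \<and> r < 1 \<and> x \<in> A}"
    by blast
qed

lemma emeasure_sphere_measure:
  fixes A :: "'a::euclidean_space set"
  assumes A: "A \<in> sets borel" "A \<subseteq> sphere 0 1"
  shows "emeasure sphere_measure A
    = of_nat DIM('a) * emeasure lborel {r *\<^sub>R x | r x. 0 < r \<and> r < 1 \<and> x \<in> A}"
proof -
  let ?B = "ball 0 1 - {0} :: 'a set"
  have cont: "continuous_on ?B sgn"
    unfolding sgn_div_norm by (intro continuous_intros) auto
  have "sgn \<in> borel_measurable (restrict_space borel ?B)"
    using cont by (rule borel_measurable_continuous_on_restrict)
  then have "sgn \<in> restrict_space lborel ?B \<rightarrow>\<^sub>M restrict_space borel (sphere 0 1)"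
    by (auto intro!: measurable_restrict_space2
        simp: space_restrict_space norm_sgn measurable_cong_sets[OF sets_restrict_space_cong[OF sets_lborel] refl])
  moreover have "A \<in> sets (restrict_space borel (sphere 0 1))"
    using A by (auto simp: sets_restrict_space_iff)
  ultimately show ?thesis
    using A
    by (simp add: sphere_measure_def emeasure_distr emeasure_restrict_space space_restrict_space
        cone_eq_sgn_vimage)
qed

text \<open>Polynomial functions in the coordinates of \<open>real ^ 'n\<close> of total degree at most \<open>t\<close>;
  \<open>m\<close> ranges over the exponent vectors, \<open>c m\<close> is the coefficient of the monomial.\<close>

definition poly_fun_le :: "nat \<Rightarrow> (real ^ 'n \<Rightarrow> real) \<Rightarrow> bool" where
  "poly_fun_le t f \<longleftrightarrow>
     (\<exists>c :: ('n \<Rightarrow> nat) \<Rightarrow> real.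
        f = (\<lambda>x. \<Sum>m | (\<Sum>i\<in>UNIV. m i) \<le> t. c m * (\<Prod>i\<in>UNIV. (x $ i) ^ m i)))"

lemma finite_exponents: "finite {m :: 'n::finite \<Rightarrow> nat. (\<Sum>i\<in>UNIV. m i) \<le> t}"
proof (rule finite_subset)
  show "{m :: 'n \<Rightarrow> nat. (\<Sum>i\<in>UNIV. m i) \<le> t} \<subseteq> Pi\<^sub>E UNIV (\<lambda>_. {..t})"
  proof (clarsimp simp: PiE_UNIV_domain)
    fix m :: "'n \<Rightarrow> nat" and i
    assume "(\<Sum>i\<in>UNIV. m i) \<le> t"
    moreover have "m i \<le> (\<Sum>i\<in>UNIV. m i)"
      by (rule member_le_sum) auto
    ultimately show "m i \<le> t" by linarith
  qed
qed (simp add: finite_PiE)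

definition spherical_design :: "nat \<Rightarrow> (real ^ 'n) set \<Rightarrow> bool" where
  "spherical_design t C \<longleftrightarrow>
     finite C \<and> C \<subseteq> sphere 0 1 \<and>
     (\<forall>f. poly_fun_le t f \<longrightarrow>
        1 / measure sphere_measure (sphere 0 1 :: (real ^ 'n) set) * (\<integral>x. f x \<partial>sphere_measure)
          = 1 / real (card C) * (\<Sum>x\<in>C. f x))"

definition inner_products :: "'a::real_inner set \<Rightarrow> real set" where
  "inner_products C = {x \<bullet> y | x y. x \<in> C \<and> y \<in> C \<and> x \<noteq> y}"

definition s_distance :: "nat \<Rightarrow> 'a::real_inner set \<Rightarrow> bool" where
  "s_distance s C \<longleftrightarrow> finite (inner_products C) \<and> card (inner_products C) = s"

end

theory Submission
  imports Defs "HOL-Computational_Algebra.Polynomial"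
begin

text \<open>
  Rotation invariance of the surface measure shows that the averages of \<open>(v \<bullet> z) ^ k\<close> over \<open>z \<in> C\<close>
  are those of the sphere for \<open>k \<le> t\<close>. Polarising, one gets the addition formula
  for the Gegenbauer polynomials \<open>P k\<close> summed over \<open>C\<close>, so for \<open>k < s\<close> the matrices
  \<open>E k = m k * P k (x \<bullet> y) / card C\<close>, with \<open>m k\<close> the dimension of the harmonic polynomials of
  degree \<open>k\<close>, are orthogonal idempotents; let \<open>E s\<close> be the complementary idempotent and
  \<open>m s\<close> its trace. The number of \<open>z\<close> with \<open>x \<bullet> z = a\<close> does not depend on \<open>x \<in> C\<close>, and weighting
  the pairs with \<open>x \<bullet> z = z \<bullet> y\<close> by the inverse of this number gives a rational matrix, whose
  spectral decomposition is, up to a scalar, the sum of the \<open>E k / m k\<close>. Hence \<open>E k\<close> is rational whenever \<open>m k\<close>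
  is a simple value. As \<open>m\<close> is strictly increasing below \<open>s\<close>, only one \<open>k\<close> can collide with \<open>s\<close>. Either \<open>E 1\<close> is
  rational, and we are done, or \<open>E 2\<close>, \<open>E 3\<close> and \<open>E 5\<close> are, which suffices because \<open>P 2\<close> then makes
  \<open>(x \<bullet> y)\<^sup>2\<close> rational, while \<open>P 3\<close> and \<open>P 5\<close> are odd without common nonzero root.
\<close>

section \<open>Rotation invariance of the surface measure\<close>

text \<open>By Vitali covering, \<open>S\<close> is up to a null set a disjoint union of balls, and \<open>f\<close> preserves balls
  and their radii.\<close>

lemma emeasure_orthogonal_vimage_open:
  fixes f :: "'a::euclidean_space \<Rightarrow> 'a"
  assumes f: "orthogonal_transformation f" and S: "open S"
  shows "emeasure lborel (f -` S) = emeasure lborel S"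
proof -
  define g where "g = inv f"
  have g: "orthogonal_transformation g"
    unfolding g_def by (rule orthogonal_transformation_inv[OF f])
  have bij: "bij f" by (rule orthogonal_transformation_bij[OF f])
  have vim: "f -` T = g ` T" for T
    by (metis bij bij_vimage_eq_inv_image g_def)
  have lin: "linear f" "linear g"
    using f g by (simp_all add: orthogonal_transformation_linear)
  have meas: "f \<in> borel \<rightarrow>\<^sub>M borel"
    using lin by (intro borel_measurable_continuous_onI linear_continuous_on)
      (simp add: linear_conv_bounded_linear)
  \<comment> \<open>Balls are coded as pairs of centre and radius.\<close>
  define K where "K = {i. 0 < snd i \<and> ball (fst i) (snd i) \<subseteq> S}"
  have cov: "\<exists>i\<in>K. x \<in> ball (fst i) (snd i) \<and> snd i < d" if "x \<in> S" "0 < d" for x d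
  proof -
    from S \<open>x \<in> S\<close> obtain e where e: "e > 0" "ball x e \<subseteq> S"
      by (auto simp: open_contains_ball)
    define r where "r = min e (d/2)"
    have "(x, r) \<in> K" "x \<in> ball x r" "r < d"
      using e that by (auto simp: K_def r_def)
    then show ?thesis by force
  qed
  obtain C where C: "countable C" "C \<subseteq> K"
     "pairwise (\<lambda>i j. disjnt (ball (fst i) (snd i)) (ball (fst j) (snd j))) C"
     "negligible (S - (\<Union>i \<in> C. ball (fst i) (snd i)))"
    by (rule Vitali_covering_theorem_balls[of S K fst snd]) (use cov in blast)
  let ?B = "\<lambda>i. ball (fst i) (snd i)"
  define U where "U = (\<Union>i\<in>C. ?B i)"
  have US: "U \<subseteq> S" using C(2) unfolding U_def K_def by blast
  have openU: "open U" by (auto simp: U_def)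
  have nullS: "S - U \<in> null_sets lborel"
    using C(4) S openU by (simp add: U_def negligible_iff_null_sets null_sets_completion_iff)
  \<comment> \<open>\<open>g\<close> is linear, hence differentiable, so it sends the uncovered null
    set to a null set.\<close>
  have "negligible (g ` (S - U))"
    using C(4) by (intro negligible_differentiable_image_negligible)
      (auto simp: U_def lin linear_imp_differentiable_on)
  moreover have gSU: "g ` (S - U) \<in> sets borel"
  proof -
    have "f -` (S - U) \<inter> space borel \<in> sets borel"
      by (rule measurable_sets[OF meas]) (use S openU in auto)
    then show ?thesis by (simp add: vim)
  qed
  ultimately have nullg: "f -` (S - U) \<in> null_sets lborel"
    by (simp add: vim negligible_iff_null_sets null_sets_completion_iff)
  have vb: "f -` ?B i = ball (g (fst i)) (snd i)" for i
    using image_orthogonal_transformation_ball[OF g] by (simp add: vim)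
  have disj: "disjoint_family_on ?B C"
    using C(3) by (auto simp: disjoint_family_on_def pairwise_def disjnt_def)
  then have disj': "disjoint_family_on (\<lambda>i. f -` ?B i) C"
    unfolding disjoint_family_on_def by blast
  have "emeasure lborel S = emeasure lborel (U \<union> (S - U))"
    using US by (simp add: Un_absorb1)
  also have "\<dots> = emeasure lborel U"
    by (rule emeasure_Un_null_set) (use openU nullS in auto)
  also have "\<dots> = (\<integral>\<^sup>+i. emeasure lborel (?B i) \<partial>count_space C)"
    unfolding U_def by (rule emeasure_UN_countable[OF _ C(1) disj]) auto
  also have "\<dots> = (\<integral>\<^sup>+i. emeasure lborel (f -` ?B i) \<partial>count_space C)"
    using C(2) by (intro nn_integral_cong) (auto simp: vb emeasure_ball K_def)
  also have "\<dots> = emeasure lborel (\<Union>i\<in>C. f -` ?B i)"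
    by (rule emeasure_UN_countable[symmetric, OF _ C(1) disj']) (simp add: vb)
  also have "(\<Union>i\<in>C. f -` ?B i) = f -` U"
    by (auto simp: U_def)
  also have "emeasure lborel (f -` U) = emeasure lborel (f -` U \<union> f -` (S - U))"
  proof (rule emeasure_Un_null_set[symmetric, OF _ nullg])
    show "f -` U \<in> sets lborel"
      using measurable_sets[OF meas, of U] openU by simp
  qed
  also have "f -` U \<union> f -` (S - U) = f -` S"
    using US by auto
  finally show ?thesis by simp
qed

text \<open>\<open>lborel\<close> is characterised by its values on open boxes, so invariance on
  open sets suffices.\<close>

lemma distr_lborel_orthogonal:
  fixes f :: "'a::euclidean_space \<Rightarrow> 'a"
  assumes f: "orthogonal_transformation f"
  shows "distr lborel borel f = lborel"
proof (rule lborel_eqI[symmetric])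
  have meas: "f \<in> borel \<rightarrow>\<^sub>M borel"
    using orthogonal_transformation_linear[OF f]
    by (intro borel_measurable_continuous_onI linear_continuous_on)
      (simp add: linear_conv_bounded_linear)
  fix l u :: 'a
  assume "\<And>b. b \<in> Basis \<Longrightarrow> l \<bullet> b \<le> u \<bullet> b"
  then show "emeasure (distr lborel borel f) (box l u) = (\<Prod>b\<in>Basis. (u - l) \<bullet> b)"
    using emeasure_orthogonal_vimage_open[OF f open_box, of l u] meas
    by (simp add: emeasure_distr emeasure_lborel_box)
qed simp

lemma integral_sphere_measure_orthogonal:
  fixes f :: "'a::euclidean_space \<Rightarrow> 'a" and h :: "'a \<Rightarrow> real"
  assumes f: "orthogonal_transformation f" and h: "h \<in> borel_measurable borel"
  shows "(\<integral>x. h (f x) \<partial>sphere_measure) = (\<integral>x. h x \<partial>sphere_measure)"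
proof -
  let ?M = "sphere_measure :: 'a measure"
  let ?S = "sphere 0 1 :: 'a set"
  have nf: "norm (f x) = norm x" for x
    using f by (simp add: orthogonal_transformation_norm)
  have f0: "f x = 0 \<longleftrightarrow> x = 0" for x
    using nf by (metis norm_eq_zero)
  have sgnf: "sgn (f x) = f (sgn x)" for x
    by (simp add: sgn_div_norm nf orthogonal_transformation_scaleR[OF f])
  have measb: "f \<in> borel \<rightarrow>\<^sub>M borel"
    using orthogonal_transformation_linear[OF f]
    by (intro borel_measurable_continuous_onI linear_continuous_on)
      (simp add: linear_conv_bounded_linear)
  have "f \<in> restrict_space borel ?S \<rightarrow>\<^sub>M restrict_space borel ?S"
    using measb by (intro measurable_restrict_space3) (auto simp: nf)
  then have meas: "f \<in> ?M \<rightarrow>\<^sub>M ?M"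
    by (simp add: measurable_cong_sets[OF sets_sphere_measure sets_sphere_measure])
  have "distr ?M ?M f = ?M"
  proof (rule measure_eqI)
    fix A assume "A \<in> sets (distr ?M ?M f)"
    then have A: "A \<in> sets borel" "A \<subseteq> ?S"
      by (auto simp: sets_sphere_measure sets_restrict_space_iff)
    define B where "B = f -` A"
    have B: "B \<in> sets borel" "B \<subseteq> ?S"
      using measurable_sets[OF measb A(1)] A(2) nf by (auto simp: B_def)
    define K where "K = {r *\<^sub>R x | r x. 0 < r \<and> r < 1 \<and> x \<in> A}"
    have "continuous_on (ball 0 1 - {0}) (sgn :: 'a \<Rightarrow> 'a)"
      unfolding sgn_div_norm by (intro continuous_intros) auto
    then have "sgn \<in> borel_measurable (restrict_space borel (ball 0 1 - {0::'a}))"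
      by (rule borel_measurable_continuous_on_restrict)
    then have "sgn -` A \<inter> space (restrict_space borel (ball 0 1 - {0}))
        \<in> sets (restrict_space borel (ball 0 1 - {0::'a}))"
      using A(1) by (rule measurable_sets)
    then have Kb: "K \<in> sets borel"
      unfolding K_def cone_eq_sgn_vimage[OF A(2)]
      by (simp add: space_restrict_space sets_restrict_space_iff)
    have "{r *\<^sub>R x | r x. 0 < r \<and> r < 1 \<and> x \<in> B} = f -` K"
      unfolding K_def cone_eq_sgn_vimage[OF A(2)] cone_eq_sgn_vimage[OF B(2)]
      by (auto simp: B_def nf f0 sgnf)
    then have "emeasure ?M B = of_nat DIM('a) * emeasure lborel (f -` K)"
      by (simp add: emeasure_sphere_measure[OF B])
    also have "emeasure lborel (f -` K) = emeasure (distr lborel borel f) K"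
      using Kb measb by (simp add: emeasure_distr)
    also have "of_nat DIM('a) * emeasure (distr lborel borel f) K = emeasure ?M A"
      by (simp add: emeasure_sphere_measure[OF A] distr_lborel_orthogonal[OF f] K_def)
    finally show "emeasure (distr ?M ?M f) A = emeasure ?M A"
      using A B meas
      by (subst emeasure_distr[OF meas])
        (auto simp: sets_sphere_measure sets_restrict_space_iff space_sphere_measure B_def
          intro: arg_cong[of _ _ "emeasure ?M"] simp flip: B_def simp: Int_absorb2)
  qed simp
  moreover have "h \<in> borel_measurable ?M"
    using h by (simp add: measurable_cong_sets[OF sets_sphere_measure refl] measurable_restrict_space1)
  ultimately show ?thesis
    using integral_distr[OF meas, of h] by simp
qed

section \<open>Polynomial functions and the moments of a design\<close>

lemma poly_fun_le_monomial:
  fixes m :: "'n::finite \<Rightarrow> nat"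
  assumes "(\<Sum>i\<in>UNIV. m i) \<le> t"
  shows "poly_fun_le t (\<lambda>x :: real^'n. a * (\<Prod>i\<in>UNIV. (x $ i) ^ m i))"
  unfolding poly_fun_le_def
proof (intro exI[of _ "\<lambda>m'. if m' = m then a else 0"] ext)
  fix x :: "real^'n"
  show "a * (\<Prod>i\<in>UNIV. (x $ i) ^ m i) = (\<Sum>m' | (\<Sum>i\<in>UNIV. m' i) \<le> t.
      (if m' = m then a else 0) * (\<Prod>i\<in>UNIV. (x $ i) ^ m' i))"
    using assms by (simp add: if_distrib[of "\<lambda>u. u * _"] finite_exponents cong: if_cong)
qed

lemma poly_fun_le_add:
  assumes "poly_fun_le t f" "poly_fun_le t g"
  shows "poly_fun_le t (\<lambda>x. f x + g x)"
proof -
  from assms obtain c d where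
    "f = (\<lambda>x. \<Sum>m | (\<Sum>i\<in>UNIV. m i) \<le> t. c m * (\<Prod>i\<in>UNIV. (x $ i) ^ m i))"
    "g = (\<lambda>x. \<Sum>m | (\<Sum>i\<in>UNIV. m i) \<le> t. d m * (\<Prod>i\<in>UNIV. (x $ i) ^ m i))"
    unfolding poly_fun_le_def by blast
  then show ?thesis
    unfolding poly_fun_le_def
    by (intro exI[of _ "\<lambda>m. c m + d m"]) (simp add: sum.distrib algebra_simps)
qed

lemma poly_fun_le_sum:
  assumes "finite I" "\<And>i. i \<in> I \<Longrightarrow> poly_fun_le t (f i)"
  shows "poly_fun_le t (\<lambda>x. \<Sum>i\<in>I. f i x)"
  using assms
proof (induction I)
  case empty
  show ?case unfolding poly_fun_le_def by (intro exI[of _ "\<lambda>_. 0"]) simp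
next
  case (insert i I)
  then show ?case by (simp add: poly_fun_le_add)
qed

text \<open>Expanding \<open>v \<bullet> x\<close> in coordinates, each summand raises one exponent
  of a monomial by one.\<close>

lemma poly_fun_le_inner_mult:
  fixes v :: "real^'n"
  assumes "poly_fun_le t f"
  shows "poly_fun_le (Suc t) (\<lambda>x. (v \<bullet> x) * f x)"
proof -
  from assms obtain c where
    f: "f = (\<lambda>x. \<Sum>m | (\<Sum>i\<in>UNIV. m i) \<le> t. c m * (\<Prod>i\<in>UNIV. (x $ i) ^ m i))"
    unfolding poly_fun_le_def by blast
  have eq: "(v \<bullet> x) * f x = (\<Sum>j\<in>UNIV. \<Sum>m | (\<Sum>i\<in>UNIV. m i) \<le> t.
      (v $ j * c m) * (\<Prod>i\<in>UNIV. (x $ i) ^ (m(j := Suc (m j))) i))" for x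
  proof -
    have mono: "x $ j * (\<Prod>i\<in>UNIV. (x $ i) ^ m i) = (\<Prod>i\<in>UNIV. (x $ i) ^ (m(j := Suc (m j))) i)"
      for j and m :: "'n \<Rightarrow> nat"
      by (simp add: prod.remove[of UNIV j])
    then have "v $ j * x $ j * (c m * (\<Prod>i\<in>UNIV. (x $ i) ^ m i)) =
       (v $ j * c m) * (\<Prod>i\<in>UNIV. (x $ i) ^ (m(j := Suc (m j))) i)" for j m
      by (simp only: mono[symmetric] mult.assoc mult.left_commute)
    then show ?thesis
      unfolding f inner_vec_def sum_product inner_real_def by (simp only:)
  qed
  have "(\<Sum>i\<in>UNIV. (m(j := Suc (m j))) i) \<le> Suc t" if "(\<Sum>i\<in>UNIV. m i) \<le> t"
    for j and m :: "'n \<Rightarrow> nat"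
    using that by (simp add: sum.remove[of UNIV j])
  then show ?thesis
    unfolding eq by (intro poly_fun_le_sum poly_fun_le_monomial) (auto simp: finite_exponents)
qed

lemma poly_fun_le_inner_power: "poly_fun_le k (\<lambda>x :: real^'n. (v \<bullet> x) ^ k)"
proof (induction k)
  case 0
  show ?case using poly_fun_le_monomial[of "\<lambda>_. 0" 0 1] by simp
next
  case (Suc k)
  then show ?case using poly_fun_le_inner_mult by simp
qed

lemma poly_fun_le_mono:
  assumes "poly_fun_le s f" "s \<le> t"
  shows "poly_fun_le t f"
proof -
  from assms obtain c where
    f: "f = (\<lambda>x. \<Sum>m | (\<Sum>i\<in>UNIV. m i) \<le> s. c m * (\<Prod>i\<in>UNIV. (x $ i) ^ m i))"
    unfolding poly_fun_le_def by blast
  show ?thesis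
    unfolding f using assms(2)
    by (intro poly_fun_le_sum poly_fun_le_monomial) (auto simp: finite_exponents)
qed

text \<open>An orthogonal map carrying \<open>v\<close> to \<open>w\<close> shows that the two
  sphere integrals agree, and the design property turns them into sums over
  \<open>C\<close>.\<close>

lemma spherical_design_moment_cong:
  fixes C :: "(real^'n) set"
  assumes "spherical_design t C" "k \<le> t" "norm v = norm w"
  shows "(\<Sum>z\<in>C. (v \<bullet> z) ^ k) = (\<Sum>z\<in>C. (w \<bullet> z) ^ k)"
proof (cases "card C = 0")
  case True
  then show ?thesis
    using assms(1) by (auto simp: spherical_design_def)
next
  case False
  obtain f where f: "orthogonal_transformation f" "f v = w"
    using orthogonal_transformation_exists[OF assms(3)] by blast
  have "(\<integral>x. (v \<bullet> x) ^ k \<partial>sphere_measure) = (\<integral>x. (w \<bullet> f x) ^ k \<partial>sphere_measure)"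
    using f by (metis orthogonal_transformation_def)
  also have "\<dots> = (\<integral>x. (w \<bullet> x) ^ k \<partial>sphere_measure)"
    by (rule integral_sphere_measure_orthogonal[OF f(1), of "\<lambda>x. (w \<bullet> x) ^ k"]) measurable
  finally have "1 / real (card C) * (\<Sum>z\<in>C. (v \<bullet> z) ^ k) = 1 / real (card C) * (\<Sum>z\<in>C. (w \<bullet> z) ^ k)"
    using assms(1) poly_fun_le_mono[OF poly_fun_le_inner_power assms(2)]
    unfolding spherical_design_def by metis
  then show ?thesis using False by simp
qed

section \<open>Coefficients of powers of a quadratic\<close>

text \<open>For unit vectors with inner product \<rho>, the quadratic in \<open>r\<close> is the
  squared norm of \<open>x + r *\<^sub>R y\<close>. Each factor \<rho> comes with a power of
  \<open>r\<close>, which bounds the degree.\<close>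

lemma coeff_quadratic_power:
  "\<exists>p. degree p \<le> j \<and> (\<forall>\<rho>::real. coeff ([:1, 2 * \<rho>, 1:] ^ h) j = poly p \<rho>)"
proof (induction h arbitrary: j)
  case 0
  show ?case
    by (intro exI[of _ "if j = 0 then 1 else 0"]) (auto simp: coeff_1)
next
  case (Suc h)
  \<comment> \<open>Subtraction of naturals truncates, hence the guards for small
    \<open>j\<close>.\<close>
  have step: "coeff ([:1, 2 * \<rho>, 1:] ^ Suc h) j =
      coeff ([:1, 2 * \<rho>, 1:] ^ h) j
      + (if j = 0 then 0 else 2 * \<rho> * coeff ([:1, 2 * \<rho>, 1:] ^ h) (j - 1))
      + (if j < 2 then 0 else coeff ([:1, 2 * \<rho>, 1:] ^ h) (j - 2))" for \<rho> :: real
    by (cases j; cases "j - 1") (auto simp: coeff_pCons split: nat.splits)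
  obtain p0 where p0: "degree p0 \<le> j" "\<And>\<rho>::real. coeff ([:1, 2 * \<rho>, 1:] ^ h) j = poly p0 \<rho>"
    using Suc.IH[of j] by blast
  obtain p1 where p1: "degree p1 \<le> j - 1"
    "\<And>\<rho>::real. coeff ([:1, 2 * \<rho>, 1:] ^ h) (j - 1) = poly p1 \<rho>"
    using Suc.IH[of "j - 1"] by blast
  obtain p2 where p2: "degree p2 \<le> j - 2"
    "\<And>\<rho>::real. coeff ([:1, 2 * \<rho>, 1:] ^ h) (j - 2) = poly p2 \<rho>"
    using Suc.IH[of "j - 2"] by blast
  let ?p = "p0 + (if j = 0 then 0 else [:0, 2:] * p1) + (if j < 2 then 0 else p2)"
  have "degree ([:0, 2:] * p1) \<le> j" if "j \<noteq> 0"
    using degree_mult_le[of "[:0, 2:]" p1] p1(1) that by simp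
  then have "degree ?p \<le> j"
    using p0(1) p2(1) by (intro degree_add_le) auto
  moreover have "coeff ([:1, 2 * \<rho>, 1:] ^ Suc h) j = poly ?p \<rho>" for \<rho> :: real
    unfolding step p0(2) p1(2) p2(2) by simp
  ultimately show ?case by blast
qed

text \<open>The coefficient of order 2 yields the moment recursion \<open>moment_Suc_Suc\<close>;
  the other two feed its induction.\<close>

lemma coeff_quadratic_power_le_2:
  fixes \<rho> :: real
  shows "coeff ([:1, 2 * \<rho>, 1:] ^ h) 0 = 1"
    and "coeff ([:1, 2 * \<rho>, 1:] ^ h) 1 = 2 * real h * \<rho>"
    and "coeff ([:1, 2 * \<rho>, 1:] ^ h) 2 = real h + 2 * real h * (real h - 1) * \<rho>\<^sup>2"
proof -
  show c0: "coeff ([:1, 2 * \<rho>, 1:] ^ h) 0 = 1" for h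
    by (induction h) (auto simp: coeff_1)
  show c1: "coeff ([:1, 2 * \<rho>, 1:] ^ h) 1 = 2 * real h * \<rho>" for h
    using c0 by (induction h) (auto simp: coeff_1 coeff_pCons algebra_simps)
  show "coeff ([:1, 2 * \<rho>, 1:] ^ h) 2 = real h + 2 * real h * (real h - 1) * \<rho>\<^sup>2"
  proof (induction h)
    case (Suc h)
    have step: "coeff ([:1, 2 * \<rho>, 1:] ^ Suc h) 2 = coeff ([:1, 2 * \<rho>, 1:] ^ h) 2
       + 2 * \<rho> * coeff ([:1, 2 * \<rho>, 1:] ^ h) 1 + coeff ([:1, 2 * \<rho>, 1:] ^ h) 0"
      by (simp add: numeral_2_eq_2 coeff_pCons)
    show ?case
      unfolding step Suc.IH c0 c1 by (simp add: algebra_simps power2_eq_square)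
  qed (auto simp: coeff_1)
qed

section \<open>Averages over a design\<close>

locale design =
  fixes C :: "(real^'n) set" and t :: nat
  assumes design: "spherical_design t C" and nonempty: "C \<noteq> {}"
begin

lemma finite_C: "finite C"
  using design by (simp add: spherical_design_def)

lemma norm_C: "x \<in> C \<Longrightarrow> norm x = 1"
  using design by (auto simp: spherical_design_def)

lemma card_C_pos: "real (card C) > 0"
  using finite_C nonempty by (simp add: card_gt_0_iff)

definition avg :: "(real^'n \<Rightarrow> real) \<Rightarrow> real"
  where "avg f = (\<Sum>z\<in>C. f z) / card C"

lemma avg_cong: "(\<And>z. z \<in> C \<Longrightarrow> f z = g z) \<Longrightarrow> avg f = avg g"
  by (simp add: avg_def)

lemma avg_const [simp]: "avg (\<lambda>_. a) = a"
  using card_C_pos by (simp add: avg_def)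

lemma avg_diff: "avg (\<lambda>z. f z - g z) = avg f - avg g"
  by (simp add: avg_def sum_subtractf diff_divide_distrib)

lemma avg_cmult: "avg (\<lambda>z. a * f z) = a * avg f"
  by (simp add: avg_def sum_distrib_left)

lemma avg_sum: "avg (\<lambda>z. \<Sum>i\<in>I. f i z) = (\<Sum>i\<in>I. avg (f i))"
  unfolding avg_def sum_divide_distrib by (rule sum.swap)

lemma avg_swap: "avg (\<lambda>y. avg (\<lambda>z. f y z)) = avg (\<lambda>z. avg (\<lambda>y. f y z))"
  unfolding avg_def sum_divide_distrib by (rule sum.swap)

lemma avg_square_eq_0:
  assumes "avg (\<lambda>z. f z * f z) = 0" "z \<in> C"
  shows "f z = 0"
  using assms finite_C card_C_pos by (auto simp: avg_def sum_nonneg_eq_0_iff)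

text \<open>An arbitrary unit vector; by \<open>avg_inner_power\<close> the moments up to order
  \<open>t\<close> do not depend on the choice.\<close>

definition pole :: "real^'n"
  where "pole = axis undefined 1"

lemma norm_pole: "norm pole = 1"
  by (simp add: pole_def)

definition moment :: "nat \<Rightarrow> real"
  where "moment k = avg (\<lambda>z. (pole \<bullet> z) ^ k)"

lemma moment_0 [simp]: "moment 0 = 1"
  by (simp add: moment_def)

lemma avg_inner_power:
  assumes "k \<le> t"
  shows "avg (\<lambda>z. (v \<bullet> z) ^ k) = moment k * norm v ^ k"
proof -
  have "avg (\<lambda>z. (v \<bullet> z) ^ k) = avg (\<lambda>z. ((norm v *\<^sub>R pole) \<bullet> z) ^ k)"
    unfolding avg_def
    using spherical_design_moment_cong[OF design assms, of v "norm v *\<^sub>R pole"]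
    by (simp add: norm_pole)
  then show ?thesis
    by (simp add: moment_def power_mult_distrib avg_cmult)
qed

text \<open>Replacing the pole by its negative keeps the norm, hence the moment, but flips the sign
  of an odd power.\<close>

lemma moment_odd:
  assumes "k \<le> t" "odd k"
  shows "moment k = 0"
proof -
  have "avg (\<lambda>z. ((- pole) \<bullet> z) ^ k) = avg (\<lambda>z. - 1 * (pole \<bullet> z) ^ k)"
    using assms(2) by simp
  then show ?thesis
    using avg_inner_power[OF assms(1), of "- pole"]
    unfolding avg_cmult by (simp add: norm_pole moment_def)
qed

text \<open>Polarisation: compare coefficients of \<open>r\<close> in the moment of order \<open>k\<close> along \<open>x + r y\<close>.\<close>

lemma avg_mixed:
  assumes "k \<le> t" "j \<le> k" "norm x = 1" "norm y = 1"
  shows "real (k choose j) * avg (\<lambda>z. (x \<bullet> z) ^ (k - j) * (y \<bullet> z) ^ j)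
    = moment k * coeff ([:1, 2 * (x \<bullet> y), 1:] ^ (k div 2)) j"
proof -
  define p where "p = (\<Sum>j\<le>k. monom (real (k choose j) * avg (\<lambda>z. (x \<bullet> z) ^ (k - j) * (y \<bullet> z) ^ j)) j)"
  \<comment> \<open>For even \<open>k\<close> this is a power of the squared norm of
    \<open>x + r *\<^sub>R y\<close>; for odd \<open>k\<close> the moment is zero, so the rounding
    in \<open>k div 2\<close> does no harm.\<close>
  define q where "q = smult (moment k) ([:1, 2 * (x \<bullet> y), 1:] ^ (k div 2))"
  have "poly p r = poly q r" for r
  proof -
    have "((x + r *\<^sub>R y) \<bullet> z) ^ k = (\<Sum>j\<le>k. real (k choose j) * r ^ j * ((x \<bullet> z) ^ (k - j) * (y \<bullet> z) ^ j))" for z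
      using binomial_ring[of "r * (y \<bullet> z)" "x \<bullet> z" k]
      by (simp add: inner_add_left power_mult_distrib algebra_simps)
    then have "avg (\<lambda>z. ((x + r *\<^sub>R y) \<bullet> z) ^ k) = poly p r"
      by (simp add: avg_sum avg_cmult p_def poly_sum poly_monom algebra_simps)
    moreover have "moment k * norm (x + r *\<^sub>R y) ^ k = poly q r"
    proof (cases "even k")
      case True
      then obtain h where h: "k = 2 * h" by (elim evenE)
      have "x \<bullet> x = 1" "y \<bullet> y = 1"
        using assms(3,4) by (simp_all add: norm_eq_1)
      then have "norm (x + r *\<^sub>R y) ^ 2 = poly [:1, 2 * (x \<bullet> y), 1:] r"
        unfolding power2_norm_eq_inner
        by (simp add: inner_add inner_commute[of y x] power2_eq_square algebra_simps)
      then show ?thesis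
        by (simp only: q_def h power_mult poly_power poly_smult) simp
    next
      case False
      then show ?thesis by (simp add: q_def moment_odd[OF assms(1)])
    qed
    ultimately show ?thesis
      using avg_inner_power[OF assms(1)] by simp
  qed
  then have "p = q"
    by (simp add: poly_eq_poly_eq_iff[symmetric] ext)
  then have "coeff p j = coeff q j" by simp
  then show ?thesis
    using assms(2) by (simp add: p_def q_def coeff_sum if_distrib cong: if_cong)
qed

text \<open>Sum the averages of \<open>(pole \<bullet> z) ^ k * (z $ i)\<^sup>2\<close> over all
  coordinates \<open>i\<close>: since \<open>z\<close> is a unit vector the left-hand sides of
  \<open>avg_mixed\<close> add up to a multiple of \<open>moment k\<close>, the right-hand sides to
  one of \<open>moment (k + 2)\<close>.\<close>

lemma moment_Suc_Suc:
  assumes "even k" "k + 2 \<le> t"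
  shows "real (CARD('n) + k) * moment (k + 2) = real (k + 1) * moment k"
proof -
  obtain h where h: "k = 2 * h" using assms(1) by (elim evenE)
  have "real ((k + 2) choose 2) * avg (\<lambda>z. (pole \<bullet> z) ^ k * (z $ i)\<^sup>2)
     = moment (k + 2) * (real (h + 1) + 2 * real (h + 1) * real h * (pole $ i)\<^sup>2)" for i
    using avg_mixed[OF assms(2), of 2 pole "axis i 1"] h
    unfolding coeff_quadratic_power_le_2
    by (simp add: norm_pole inner_axis inner_axis' inner_commute)
  then have coeffs: "(\<Sum>i\<in>UNIV. real ((k + 2) choose 2) * avg (\<lambda>z. (pole \<bullet> z) ^ k * (z $ i)\<^sup>2))
     = (\<Sum>i\<in>UNIV. moment (k + 2) * (real (h + 1) + 2 * real (h + 1) * real h * (pole $ i)\<^sup>2))"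
    by simp
  have sq: "(\<Sum>i\<in>UNIV. (z $ i)\<^sup>2) = 1" if "norm z = 1" for z :: "real^'n"
    using that by (simp add: norm_vec_def L2_set_def)
  have "(\<Sum>i\<in>UNIV. real ((k + 2) choose 2) * avg (\<lambda>z. (pole \<bullet> z) ^ k * (z $ i)\<^sup>2))
     = real ((k + 2) choose 2) * avg (\<lambda>z. (pole \<bullet> z) ^ k * (\<Sum>i\<in>UNIV. (z $ i)\<^sup>2))"
    by (simp add: sum_distrib_left avg_sum)
  also have "avg (\<lambda>z. (pole \<bullet> z) ^ k * (\<Sum>i\<in>UNIV. (z $ i)\<^sup>2)) = moment k"
    unfolding moment_def by (rule avg_cong) (simp add: sq norm_C)
  finally have "real ((k + 2) choose 2) * moment k
     = (\<Sum>i\<in>UNIV. real ((k + 2) choose 2) * avg (\<lambda>z. (pole \<bullet> z) ^ k * (z $ i)\<^sup>2))"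
    by (rule sym)
  also note coeffs
  also have "(\<Sum>i\<in>UNIV. moment (k + 2) * (real (h + 1) + 2 * real (h + 1) * real h * (pole $ i)\<^sup>2))
     = moment (k + 2) * (CARD('n) * real (h + 1) + 2 * real (h + 1) * real h * (\<Sum>i\<in>UNIV. (pole $ i)\<^sup>2))"
    by (simp add: sum.distrib flip: sum_distrib_left)
  finally have "real ((k + 2) choose 2) * moment k = moment (k + 2) *
      (CARD('n) * real (h + 1) + 2 * real (h + 1) * real h * (\<Sum>i\<in>UNIV. (pole $ i)\<^sup>2))" .
  moreover have "real ((k + 2) choose 2) = real (h + 1) * real (k + 1)"
    by (simp add: h choose_two algebra_simps)
  ultimately have "real (h + 1) * (real (k + 1) * moment k) = real (h + 1) * (real (CARD('n) + k) * moment (k + 2))"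
    unfolding sq[OF norm_pole] by (simp add: h algebra_simps)
  then show ?thesis by simp
qed

text \<open>\<open>avg_mixed\<close> bounds the degree by the second exponent; exchanging
  \<open>x\<close> and \<open>y\<close> bounds it by the first. The minimum of both is what makes
  degrees drop in the orthogonality argument.\<close>

lemma avg_mixed_monomial:
  assumes "a + b \<le> t"
  obtains p where "degree p \<le> min a b"
    "\<And>x y. norm x = 1 \<Longrightarrow> norm y = 1 \<Longrightarrow> avg (\<lambda>z. (x \<bullet> z) ^ a * (y \<bullet> z) ^ b) = poly p (x \<bullet> y)"
proof -
  have *: "\<exists>p. degree p \<le> b \<and> (\<forall>x y. norm x = 1 \<longrightarrow> norm y = 1 \<longrightarrow>
      avg (\<lambda>z. (x \<bullet> z) ^ a * (y \<bullet> z) ^ b) = poly p (x \<bullet> y))" if "a + b \<le> t" for a b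
  proof -
    obtain p where p: "degree p \<le> b"
      "\<And>\<rho>::real. coeff ([:1, 2 * \<rho>, 1:] ^ ((a + b) div 2)) b = poly p \<rho>"
      using coeff_quadratic_power by blast
    have "avg (\<lambda>z. (x \<bullet> z) ^ a * (y \<bullet> z) ^ b)
        = poly (smult (moment (a + b) / ((a + b) choose b)) p) (x \<bullet> y)"
      if "norm x = 1" "norm y = 1" for x y
      using avg_mixed[OF \<open>a + b \<le> t\<close> _ that, of b] p(2) by (simp add: field_simps)
    moreover have "degree (smult (moment (a + b) / ((a + b) choose b)) p) \<le> b"
      using degree_smult_le p(1) le_trans by blast
    ultimately show ?thesis by blast
  qed
  show thesis
  proof (cases "b \<le> a")
    case True
    then show ?thesis using *[OF assms] that by (auto simp: min_def)
  next
    case False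
    have "b + a \<le> t" using assms by simp
    from *[OF this] obtain p where p: "degree p \<le> a"
      "\<And>x y. norm x = 1 \<Longrightarrow> norm y = 1 \<Longrightarrow> avg (\<lambda>z. (x \<bullet> z) ^ b * (y \<bullet> z) ^ a) = poly p (x \<bullet> y)"
      by blast
    show ?thesis
    proof
      show "degree p \<le> min a b" using p(1) False by simp
      fix x y :: "real^'n" assume "norm x = 1" "norm y = 1"
      then show "avg (\<lambda>z. (x \<bullet> z) ^ a * (y \<bullet> z) ^ b) = poly p (x \<bullet> y)"
        using p(2)[of y x] by (simp add: inner_commute[of x y] mult.commute)
    qed
  qed
qed

text \<open>Zonal kernels are closed under convolution over \<open>C\<close>: expand both factors
  into monomials.\<close>

lemma avg_mixed_poly:
  assumes "degree f + degree g \<le> t"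
  obtains p where "degree p \<le> min (degree f) (degree g)"
    "\<And>x y. norm x = 1 \<Longrightarrow> norm y = 1 \<Longrightarrow>
      avg (\<lambda>z. poly f (x \<bullet> z) * poly g (y \<bullet> z)) = poly p (x \<bullet> y)"
proof -
  have "\<exists>p. degree p \<le> min a b \<and> (\<forall>x y. norm x = 1 \<longrightarrow> norm y = 1 \<longrightarrow>
      avg (\<lambda>z. (x \<bullet> z) ^ a * (y \<bullet> z) ^ b) = poly p (x \<bullet> y))" if "a + b \<le> t" for a b
    using avg_mixed_monomial[OF that] by metis
  note ex = this
  \<comment> \<open>The double sum needs one polynomial for each pair of exponents, chosen
    independently of \<open>x\<close> and \<open>y\<close>.\<close>
  define P where "P a b = (SOME p. degree p \<le> min a b \<and> (\<forall>x y. norm x = 1 \<longrightarrow> norm y = 1 \<longrightarrow>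
      avg (\<lambda>z. (x \<bullet> z) ^ a * (y \<bullet> z) ^ b) = poly p (x \<bullet> y)))" for a b
  have P: "a + b \<le> t \<Longrightarrow> degree (P a b) \<le> min a b"
    "a + b \<le> t \<Longrightarrow> norm x = 1 \<Longrightarrow> norm y = 1 \<Longrightarrow>
      avg (\<lambda>z. (x \<bullet> z) ^ a * (y \<bullet> z) ^ b) = poly (P a b) (x \<bullet> y)" for a b x y
    using someI_ex[OF ex, of a b] unfolding P_def by blast+
  define p where "p = (\<Sum>i\<le>degree f. \<Sum>j\<le>degree g. smult (coeff f i * coeff g j) (P i j))"
  show thesis
  proof
    show "degree p \<le> min (degree f) (degree g)"
      unfolding p_def
    proof (intro degree_sum_le)
      fix i j assume "i \<in> {..degree f}" "j \<in> {..degree g}"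
      then have "degree (P i j) \<le> min (degree f) (degree g)"
        using P(1)[of i j] assms by auto
      then show "degree (smult (coeff f i * coeff g j) (P i j)) \<le> min (degree f) (degree g)"
        using degree_smult_le le_trans by blast
    qed auto
    fix x y :: "real^'n" assume xy: "norm x = 1" "norm y = 1"
    have "avg (\<lambda>z. poly f (x \<bullet> z) * poly g (y \<bullet> z))
       = avg (\<lambda>z. \<Sum>i\<le>degree f. \<Sum>j\<le>degree g. (coeff f i * coeff g j) * ((x \<bullet> z) ^ i * (y \<bullet> z) ^ j))"
      unfolding poly_altdef sum_product by (simp add: ac_simps)
    also have "\<dots> = (\<Sum>i\<le>degree f. \<Sum>j\<le>degree g. (coeff f i * coeff g j) * avg (\<lambda>z. (x \<bullet> z) ^ i * (y \<bullet> z) ^ j))"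
      by (simp only: avg_sum avg_cmult)
    also have "\<dots> = (\<Sum>i\<le>degree f. \<Sum>j\<le>degree g. (coeff f i * coeff g j) * poly (P i j) (x \<bullet> y))"
      using xy assms by (intro sum.cong refl) (simp add: P(2))
    also have "\<dots> = poly p (x \<bullet> y)"
      by (simp add: p_def poly_sum)
    finally show "avg (\<lambda>z. poly f (x \<bullet> z) * poly g (y \<bullet> z)) = poly p (x \<bullet> y)" .
  qed
qed

text \<open>For degree at most \<open>t\<close> this is the sphere average of the zonal function
  given by \<open>p\<close>, whichever unit vector serves as pole
  (\<open>avg_poly_inner\<close>).\<close>

definition mean :: "real poly \<Rightarrow> real"
  where "mean p = avg (\<lambda>z. poly p (pole \<bullet> z))"

lemma avg_poly_inner:
  assumes "degree p \<le> t" "norm x = 1"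
  shows "avg (\<lambda>z. poly p (x \<bullet> z)) = mean p"
  using assms
  by (simp add: mean_def poly_altdef avg_sum avg_cmult avg_inner_power norm_pole)

lemma mean_diff: "mean (p - q) = mean p - mean q"
  by (simp add: mean_def avg_diff)

lemma mean_smult: "mean (smult a p) = a * mean p"
  by (simp add: mean_def avg_cmult)

lemma mean_monom: "mean (monom 1 k) = moment k"
  by (simp add: mean_def moment_def poly_monom)

end

section \<open>Gegenbauer polynomials and harmonic dimensions\<close>

text \<open>Gegenbauer polynomials for dimension \<open>n\<close>, normalised to have value 1 at 1.\<close>

fun gegenbauer :: "real \<Rightarrow> nat \<Rightarrow> real poly" where
  "gegenbauer n 0 = 1"
| "gegenbauer n (Suc 0) = [:0, 1:]"
| "gegenbauer n (Suc (Suc k)) = smult (1 / (real k + n - 1))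
     (smult (2 * real k + n) (pCons 0 (gegenbauer n (Suc k))) - smult (real k + 1) (gegenbauer n k))"

text \<open>The dimension of the space of harmonic polynomials of degree \<open>k\<close>.\<close>

fun harmonic_dim :: "real \<Rightarrow> nat \<Rightarrow> real" where
  "harmonic_dim n 0 = 1"
| "harmonic_dim n (Suc k) =
     harmonic_dim n k * ((n + 2 * real k) * (real k + n - 2) / ((real k + 1) * (2 * real k + n - 2)))"

text \<open>This is \<open>2 ^ k\<close> times the rising factorial of \<open>n / 2\<close>, the
  denominator of the even moments of the sphere.\<close>

definition rising2 :: "real \<Rightarrow> nat \<Rightarrow> real"
  where "rising2 n k = (\<Prod>i<k. n + 2 * real i)"

lemma rising2_0 [simp]: "rising2 n 0 = 1"
  by (simp add: rising2_def)

lemma rising2_Suc [simp]: "rising2 n (Suc k) = rising2 n k * (n + 2 * real k)"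
  by (simp add: rising2_def)

lemma rising2_pos: "n > 0 \<Longrightarrow> rising2 n k > 0"
  unfolding rising2_def by (intro prod_pos) auto

lemma gegenbauer_1: "n > 2 \<Longrightarrow> poly (gegenbauer n k) 1 = 1"
  by (induction n k rule: gegenbauer.induct) (auto simp: field_simps)

lemma degree_gegenbauer_le: "degree (gegenbauer n k) \<le> k"
proof (induction n k rule: gegenbauer.induct)
  case (3 n k)
  have "degree (pCons 0 (gegenbauer n (Suc k))) \<le> Suc (Suc k)"
    using 3 degree_pCons_le le_trans by blast
  moreover have "degree (gegenbauer n k) \<le> Suc (Suc k)"
    using 3 by simp
  ultimately show ?case
    unfolding gegenbauer.simps
    by (meson degree_diff_le degree_smult_le le_trans)
qed auto

lemma coeff_gegenbauer_Suc_Suc: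
  "coeff (gegenbauer n (Suc (Suc k))) (Suc (Suc k))
    = (2 * real k + n) / (real k + n - 1) * coeff (gegenbauer n (Suc k)) (Suc k)"
  using degree_gegenbauer_le[of n k] by (simp add: coeff_eq_0)

lemma coeff_gegenbauer_pos: "n > 2 \<Longrightarrow> coeff (gegenbauer n k) k > 0"
proof (induction n k rule: gegenbauer.induct)
  case (3 n k)
  then show ?case unfolding coeff_gegenbauer_Suc_Suc by simp
qed auto

text \<open>The leading coefficients are nonzero, so the top degree can be peeled off
  repeatedly.\<close>

lemma gegenbauer_span:
  assumes "n > 2"
  shows "degree p \<le> m \<Longrightarrow> \<exists>e. p = (\<Sum>k\<le>m. smult (e k) (gegenbauer n k))"
proof (induction m arbitrary: p)
  case 0
  then obtain a where "p = [:a:]" by (metis le_zero_eq degree_eq_zeroE)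
  then show ?case by (intro exI[of _ "\<lambda>_. a"]) simp
next
  case (Suc m)
  let ?P = "gegenbauer n (Suc m)"
  define a where "a = coeff p (Suc m) / coeff ?P (Suc m)"
  have "degree (p - smult a ?P) \<le> Suc m"
    using Suc.prems degree_gegenbauer_le[of n "Suc m"] degree_smult_le[of a ?P]
    by (intro degree_diff_le) auto
  moreover have "coeff (p - smult a ?P) (Suc m) = 0"
    using coeff_gegenbauer_pos[OF assms, of "Suc m"] by (simp add: a_def)
  ultimately have "degree (p - smult a ?P) \<le> m"
    by (metis degree_0 le_SucE leading_coeff_0_iff le0)
  from Suc.IH[OF this] obtain e where e: "p - smult a ?P = (\<Sum>k\<le>m. smult (e k) (gegenbauer n k))"
    by blast
  have "p = (p - smult a ?P) + smult a ?P" by simp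
  also have "\<dots> = (\<Sum>k\<le>Suc m. smult ((e(Suc m := a)) k) (gegenbauer n k))"
    unfolding e by simp
  finally show ?case by blast
qed

lemma harmonic_dim_pos: "n > 2 \<Longrightarrow> harmonic_dim n k > 0"
  by (induction k) (auto intro!: mult_pos_pos divide_pos_pos)

text \<open>The ratio of consecutive values exceeds 1: with \<open>e = n - 2 > 0\<close>, numerator
  minus denominator is \<open>e + e * e + 2 * real k * e\<close>.\<close>

lemma harmonic_dim_strict_mono:
  assumes "n > 2"
  shows "strict_mono (harmonic_dim n)"
proof (rule strict_mono_Suc_iff[THEN iffD2], rule allI)
  fix k
  define e where "e = n - 2"
  have "(n + 2 * real k) * (real k + n - 2) - (real k + 1) * (2 * real k + n - 2) = e + e * e + 2 * real k * e"
    by (simp add: e_def algebra_simps)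
  moreover have "e > 0" using assms by (simp add: e_def)
  then have "e + e * e + 2 * real k * e > 0" by (simp add: add_pos_nonneg)
  ultimately have "1 < (n + 2 * real k) * (real k + n - 2) / ((real k + 1) * (2 * real k + n - 2))"
    using assms by (subst less_divide_eq_1_pos) auto
  then show "harmonic_dim n k < harmonic_dim n (Suc k)"
    using mult_strict_left_mono[OF _ harmonic_dim_pos[OF assms, of k]] by fastforce
qed

lemma harmonic_dim_Rats: "n \<in> \<rat> \<Longrightarrow> harmonic_dim n k \<in> \<rat>"
  by (induction k) auto

text \<open>The right-hand side will appear as the mean of the square of the polynomial. From
  \<open>k + 1\<close> to \<open>k + 2\<close> both sides change by the same factor, by
  \<open>coeff_gegenbauer_Suc_Suc\<close>.\<close>

lemma harmonic_dim_eq: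
  assumes "n > 2"
  shows "1 / harmonic_dim n k = coeff (gegenbauer n k) k * fact k / rising2 n k"
proof (induction k rule: induct_nat_012)
  case (ge2 k)
  have "rising2 n (Suc k) > 0" "harmonic_dim n (Suc k) > 0"
    using assms by (auto intro: rising2_pos harmonic_dim_pos simp del: rising2_Suc harmonic_dim.simps)
  have "1 / harmonic_dim n (Suc (Suc k))
    = 1 / harmonic_dim n (Suc k) * ((real k + 2) * (2 * real k + n) / ((n + 2 * real k + 2) * (real k + n - 1)))"
    unfolding harmonic_dim.simps(2)[of n "Suc k"] by (simp add: algebra_simps)
  also have "\<dots> = coeff (gegenbauer n (Suc (Suc k))) (Suc (Suc k)) * fact (Suc (Suc k)) / rising2 n (Suc (Suc k))"
    unfolding ge2(2) coeff_gegenbauer_Suc_Suc rising2_Suc[of n "Suc k"]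
    by (simp add: algebra_simps del: rising2_Suc gegenbauer.simps)
  finally show ?case .
qed (use assms in \<open>auto simp: field_simps\<close>)

text \<open>Mean of \<open>x ^ (k + 2 * i)\<close> times the \<open>k\<close>-th Gegenbauer polynomial.\<close>

definition gegenbauer_mean :: "real \<Rightarrow> nat \<Rightarrow> nat \<Rightarrow> real"
  where "gegenbauer_mean n k i = fact (k + 2 * i) / (2 ^ i * fact i * rising2 n (k + i))"

text \<open>This mirrors the three-term recursion of \<open>gegenbauer\<close>, with the factor
  \<open>x\<close> moved into the monomial.\<close>

lemma gegenbauer_mean_Suc:
  assumes "n > 2"
  shows "gegenbauer_mean n (Suc (Suc k)) i = ((2 * real k + n) * gegenbauer_mean n (Suc k) (Suc i)
     - (real k + 1) * gegenbauer_mean n k (Suc i)) / (real k + n - 1)"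
proof -
  define F where "F = (fact (k + 2 * i + 2) :: real)"
  define Q where "Q = rising2 n (k + i + 1)"
  define G where "G = (2 ^ i * fact i :: real)"
  have pos: "Q > 0" "G > 0" "n + 2 * (real k + real i + 1) > 0" "real i + 1 > 0" "real k + n - 1 > 0"
    using assms by (auto simp: Q_def G_def rising2_pos)
  have a: "gegenbauer_mean n (Suc (Suc k)) i = F / (G * (Q * (n + 2 * (real k + real i + 1))))"
    by (simp add: gegenbauer_mean_def F_def G_def Q_def)
  have b: "gegenbauer_mean n (Suc k) (Suc i)
      = (real k + 2 * real i + 3) * F / (2 * (real i + 1) * G * (Q * (n + 2 * (real k + real i + 1))))"
    by (simp add: gegenbauer_mean_def F_def G_def Q_def algebra_simps)
  have c: "gegenbauer_mean n k (Suc i) = F / (2 * (real i + 1) * G * Q)"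
    by (simp add: gegenbauer_mean_def F_def G_def Q_def algebra_simps)
  show ?thesis
    unfolding a b c using pos by (simp add: divide_simps) (simp add: algebra_simps)
qed

text \<open>The boundary case of that recursion: the two terms cancel, so that polynomial
  \<open>k + 2\<close> is orthogonal to \<open>x ^ k\<close>.\<close>

lemma gegenbauer_mean_0:
  assumes "n > 0"
  shows "(2 * real k + n) * gegenbauer_mean n (Suc k) 0 = (real k + 1) * gegenbauer_mean n k 0"
proof -
  have "2 * real k + n > 0" using assms by simp
  then show ?thesis
    using rising2_pos[OF assms, of k]
    by (simp add: gegenbauer_mean_def add.commute[of n] divide_simps)
qed

text \<open>As the first Gegenbauer polynomial is \<open>x\<close>, both sides describe the moment
  of order \<open>2 * i + 2\<close>.\<close>

lemma gegenbauer_mean_Suc_0: "gegenbauer_mean n (Suc 0) i = gegenbauer_mean n 0 (Suc i)"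
proof -
  have "gegenbauer_mean n 0 (Suc i) = ((2 * (real i + 1)) * fact (Suc (2 * i)))
      / ((2 * (real i + 1)) * (2 ^ i * fact i * rising2 n (Suc i)))"
    by (simp add: gegenbauer_mean_def algebra_simps)
  also have "\<dots> = gegenbauer_mean n (Suc 0) i"
    by (subst mult_divide_mult_cancel_left) (simp_all add: gegenbauer_mean_def)
  finally show ?thesis by simp
qed

lemma gegenbauer_mean_0_Suc:
  "gegenbauer_mean n 0 (Suc i) = (2 * real i + 1) * gegenbauer_mean n 0 i / (n + 2 * real i)"
  unfolding gegenbauer_mean_Suc_0[symmetric] by (simp add: gegenbauer_mean_def algebra_simps)

section \<open>Orthogonality and addition formula over the design\<close>

locale spatial_design = design C t for C :: "(real^'n) set" and t +
  fixes n :: real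
  assumes n_eq: "n = real CARD('n)" and n: "n > 2"
begin

abbreviation P :: "nat \<Rightarrow> real poly"
  where "P k \<equiv> gegenbauer n k"

lemma mean_pCons_monom: "mean (pCons 0 p * monom 1 j) = mean (p * monom 1 (Suc j))"
  by (simp add: monom_Suc)

lemma moment_even: "2 * i \<le> t \<Longrightarrow> moment (2 * i) = gegenbauer_mean n 0 i"
proof (induction i)
  case (Suc i)
  have "(n + 2 * real i) * moment (2 * Suc i) = (2 * real i + 1) * gegenbauer_mean n 0 i"
    using moment_Suc_Suc[of "2 * i"] Suc by (simp add: n_eq)
  moreover have "n + 2 * real i > 0" using n by simp
  ultimately have "moment (2 * Suc i) = (2 * real i + 1) * gegenbauer_mean n 0 i / (n + 2 * real i)"
    by (simp add: field_simps)
  also have "\<dots> = gegenbauer_mean n 0 (Suc i)"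
    by (simp only: gegenbauer_mean_0_Suc)
  finally show ?case .
qed (simp add: gegenbauer_mean_def)

text \<open>Induction along the three-term recursion; \<open>j\<close> varies because the factor
  \<open>x\<close> moves from the polynomial to the monomial, which leaves the total degree within
  \<open>t\<close>.\<close>

lemma mean_gegenbauer_monom:
  "k + j \<le> t \<Longrightarrow> mean (P k * monom 1 j)
    = (if k \<le> j \<and> even (j - k) then gegenbauer_mean n k ((j - k) div 2) else 0)"
proof (induction k arbitrary: j rule: induct_nat_012)
  case 0
  show ?case
  proof (cases "even j")
    case True
    then show ?thesis using moment_even[of "j div 2"] 0 by (simp add: mean_monom)
  next
    case False
    then show ?thesis using moment_odd[of j] 0 by (simp add: mean_monom)
  qed
next
  case 1
  have eq: "mean (P 1 * monom 1 j) = moment (Suc j)"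
    using mean_pCons_monom[of 1 j] by (simp add: mean_monom flip: one_pCons)
  show ?case
  proof (cases "odd j")
    case True
    then obtain i where i: "j = 2 * i + 1" by (elim oddE)
    show ?thesis using eq moment_even[of "Suc i"] 1 i by (simp add: gegenbauer_mean_Suc_0)
  next
    case False
    then show ?thesis using eq moment_odd[of "Suc j"] 1 by simp
  qed
next
  case (ge2 k)
  have IH1: "mean (P (Suc k) * monom 1 (Suc j)) = (if k \<le> j \<and> even (j - k)
      then gegenbauer_mean n (Suc k) ((j - k) div 2) else 0)"
    using ge2.IH(2)[of "Suc j"] ge2.prems unfolding diff_Suc_Suc Suc_le_mono by simp
  have IH0: "mean (P k * monom 1 j) = (if k \<le> j \<and> even (j - k)
      then gegenbauer_mean n k ((j - k) div 2) else 0)"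
    using ge2.IH(1)[of j] ge2.prems by simp
  have "mean (P (Suc (Suc k)) * monom 1 j) = 1 / (real k + n - 1) *
      ((2 * real k + n) * mean (P (Suc k) * monom 1 (Suc j)) - (real k + 1) * mean (P k * monom 1 j))"
    unfolding gegenbauer.simps(3) mult_smult_left left_diff_distrib mean_smult mean_diff mean_pCons_monom ..
  also have "\<dots> = (if Suc (Suc k) \<le> j \<and> even (j - Suc (Suc k))
      then gegenbauer_mean n (Suc (Suc k)) ((j - Suc (Suc k)) div 2) else 0)"
  proof (cases "k \<le> j \<and> even (j - k)")
    case True
    then obtain i where i: "j = k + 2 * i"
      by (metis evenE le_add_diff_inverse)
    show ?thesis
    \<comment> \<open>For \<open>i = 0\<close>, that is \<open>j = k\<close>, both terms are present
      but cancel.\<close>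
    proof (cases i)
      case 0
      then show ?thesis unfolding IH1 IH0 using gegenbauer_mean_0[of n k] n i by simp
    next
      case (Suc i')
      then have "j = Suc (Suc k) + 2 * i'" using i by simp
      then show ?thesis unfolding IH1 IH0 gegenbauer_mean_Suc[OF n] by simp
    qed
  next
    case False
    then have "\<not> (Suc (Suc k) \<le> j \<and> even (j - Suc (Suc k)))"
      by auto
    then show ?thesis unfolding IH1 IH0 if_not_P[OF False] by (simp only: if_False) simp
  qed
  finally show ?case .
qed

text \<open>By linearity only the monomial of degree \<open>k\<close> in \<open>g\<close> survives;
  in particular the mean is zero if \<open>degree g < k\<close>.\<close>

lemma mean_gegenbauer_mult:
  assumes deg: "degree g \<le> k" "k + degree g \<le> t"
  shows "mean (P k * g) = coeff g k * gegenbauer_mean n k 0"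
proof -
  have "P k * g = (\<Sum>i\<le>degree g. smult (coeff g i) (P k * monom 1 i))"
    by (subst poly_as_sum_of_monoms[of g, symmetric])
      (simp add: sum_distrib_left smult_monom flip: mult_smult_right)
  then have "mean (P k * g) = (\<Sum>i\<le>degree g. coeff g i * mean (P k * monom 1 i))"
    by (simp add: mean_def poly_sum avg_sum avg_cmult)
  also have "\<dots> = (\<Sum>i\<le>degree g. if i = k then coeff g k * gegenbauer_mean n k 0 else 0)"
    using deg by (intro sum.cong refl) (auto simp: mean_gegenbauer_monom)
  also have "\<dots> = coeff g k * gegenbauer_mean n k 0"
    using deg by (auto simp: coeff_eq_0)
  finally show ?thesis .
qed

lemma mean_gegenbauer_square:
  assumes "2 * k \<le> t"
  shows "mean (P k * P k) = 1 / harmonic_dim n k"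
  using assms degree_gegenbauer_le[of n k]
  by (simp add: mean_gegenbauer_mult harmonic_dim_eq n gegenbauer_mean_def)

text \<open>If \<open>h\<close> denotes the left-hand side as a polynomial in \<open>x \<bullet> y\<close>, then exchanging the order of
  summation turns the mean of \<open>h\<^sup>2\<close> into the mean of \<open>P k\<close> times a polynomial of degree
  less than \<open>k\<close>.\<close>

lemma avg_gegenbauer_orthogonal:
  assumes deg: "degree g < k" "k + degree g \<le> t" and xy: "x \<in> C" "y \<in> C"
  shows "avg (\<lambda>z. poly (P k) (x \<bullet> z) * poly g (y \<bullet> z)) = 0"
proof -
  have dk: "degree (P k) \<le> k" by (rule degree_gegenbauer_le)
  obtain h where h: "degree h \<le> min (degree (P k)) (degree g)"
    "\<And>x y. norm x = 1 \<Longrightarrow> norm y = 1 \<Longrightarrow>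
      avg (\<lambda>z. poly (P k) (x \<bullet> z) * poly g (y \<bullet> z)) = poly h (x \<bullet> y)"
    using avg_mixed_poly[of "P k" g] dk deg by auto
  obtain p where p: "degree p \<le> min (degree g) (degree h)"
    "\<And>x y. norm x = 1 \<Longrightarrow> norm y = 1 \<Longrightarrow>
      avg (\<lambda>z. poly g (x \<bullet> z) * poly h (y \<bullet> z)) = poly p (x \<bullet> y)"
    using avg_mixed_poly[of g h] h(1) deg by auto
  have "avg (\<lambda>y. poly h (x \<bullet> y) * poly h (x \<bullet> y))
      = avg (\<lambda>y. avg (\<lambda>z. poly (P k) (x \<bullet> z) * poly g (y \<bullet> z)) * poly h (x \<bullet> y))"
    using xy norm_C by (intro avg_cong) (simp add: h(2))
  also have "\<dots> = avg (\<lambda>y. avg (\<lambda>z. poly (P k) (x \<bullet> z) * (poly g (z \<bullet> y) * poly h (x \<bullet> y))))"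
    by (subst mult.commute, subst avg_cmult[symmetric]) (simp add: ac_simps inner_commute)
  also have "\<dots> = avg (\<lambda>z. poly (P k) (x \<bullet> z) * avg (\<lambda>y. poly g (z \<bullet> y) * poly h (x \<bullet> y)))"
    by (subst avg_swap) (simp only: avg_cmult)
  also have "\<dots> = avg (\<lambda>z. poly (P k * p) (x \<bullet> z))"
    using p(2)[of _ x] xy norm_C by (intro avg_cong) (simp add: inner_commute[of x])
  also have "\<dots> = mean (P k * p)"
    using degree_mult_le[of "P k" p] dk p(1) h(1) deg xy
    by (intro avg_poly_inner) (auto simp: norm_C)
  also have "\<dots> = 0"
    using mean_gegenbauer_mult[of p k] p(1) deg by (simp add: coeff_eq_0)
  finally have "poly h (x \<bullet> y) = 0"
    by (rule avg_square_eq_0[of "\<lambda>y. poly h (x \<bullet> y)"]) (rule xy)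
  then show ?thesis
    using h(2)[of x y] xy by (simp add: norm_C)
qed

text \<open>The average is a polynomial \<open>h\<close> in \<open>x \<bullet> y\<close> of degree
  at most \<open>k\<close>. Removing its degree \<open>k\<close> part by a multiple of
  \<open>P k\<close> leaves \<open>r\<close> of lower degree; orthogonality makes the mean square of
  \<open>r\<close> over \<open>C\<close> zero, so \<open>h\<close> agrees with that multiple on
  inner products of points of \<open>C\<close>.\<close>

lemma avg_gegenbauer_same:
  assumes k: "2 * k \<le> t" and xy: "x \<in> C" "y \<in> C"
  shows "avg (\<lambda>z. poly (P k) (x \<bullet> z) * poly (P k) (y \<bullet> z)) = poly (P k) (x \<bullet> y) / harmonic_dim n k"
\<comment> \<open>The remainder \<open>r\<close> has degree less than \<open>k\<close> only if
  \<open>k\<close> is positive.\<close>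
proof (cases "k = 0")
  case True
  then show ?thesis by simp
next
  case False
  have dk: "degree (P k) \<le> k" by (rule degree_gegenbauer_le)
  obtain h where h: "degree h \<le> min (degree (P k)) (degree (P k))"
    "\<And>x y. norm x = 1 \<Longrightarrow> norm y = 1 \<Longrightarrow>
      avg (\<lambda>z. poly (P k) (x \<bullet> z) * poly (P k) (y \<bullet> z)) = poly h (x \<bullet> y)"
    using avg_mixed_poly[of "P k" "P k"] dk k by auto
  define a where "a = coeff h k / coeff (P k) k"
  define r where "r = h - smult a (P k)"
  have "degree r \<le> k"
    unfolding r_def using h(1) dk degree_smult_le[of a "P k"] by (intro degree_diff_le) auto
  moreover have rk: "coeff r k = 0"
    using coeff_gegenbauer_pos[OF n, of k] by (simp add: a_def r_def)
  ultimately have dr: "degree r < k"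
    using False by (metis degree_0 leading_coeff_0_iff le_neq_implies_less neq0_conv)
  have eq: "poly h u = a * poly (P k) u" if "x \<in> C" "y \<in> C" "u = x \<bullet> y" for x y u
  proof -
    have "avg (\<lambda>y. poly h (x \<bullet> y) * poly r (x \<bullet> y))
        = avg (\<lambda>y. avg (\<lambda>z. poly (P k) (x \<bullet> z) * poly (P k) (y \<bullet> z)) * poly r (x \<bullet> y))"
      using that norm_C by (intro avg_cong) (simp add: h(2))
    also have "\<dots> = avg (\<lambda>y. avg (\<lambda>z. poly (P k) (x \<bullet> z) * (poly (P k) (z \<bullet> y) * poly r (x \<bullet> y))))"
      by (subst mult.commute, subst avg_cmult[symmetric]) (simp add: ac_simps inner_commute)
    also have "\<dots> = avg (\<lambda>z. poly (P k) (x \<bullet> z) * avg (\<lambda>y. poly (P k) (z \<bullet> y) * poly r (x \<bullet> y)))"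
      by (subst avg_swap) (simp only: avg_cmult)
    also have "\<dots> = avg (\<lambda>z. 0)"
      using avg_gegenbauer_orthogonal[OF dr] dr k that by (intro avg_cong) simp
    finally have hr: "avg (\<lambda>y. poly h (x \<bullet> y) * poly r (x \<bullet> y)) = 0" by simp
    have "avg (\<lambda>y. poly (P k * r) (x \<bullet> y)) = mean (P k * r)"
      using degree_mult_le[of "P k" r] dk dr k that by (intro avg_poly_inner) (auto simp: norm_C)
    also have "\<dots> = 0"
      using mean_gegenbauer_mult[of r k] dr k rk by simp
    finally have pr: "avg (\<lambda>y. poly (P k * r) (x \<bullet> y)) = 0" .
    have "avg (\<lambda>y. poly r (x \<bullet> y) * poly r (x \<bullet> y))
       = avg (\<lambda>y. poly h (x \<bullet> y) * poly r (x \<bullet> y) - a * poly (P k * r) (x \<bullet> y))"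
      by (rule avg_cong) (simp add: r_def algebra_simps)
    then have "avg (\<lambda>y. poly r (x \<bullet> y) * poly r (x \<bullet> y)) = 0"
      by (simp only: avg_diff avg_cmult hr pr)
    then have "poly r (x \<bullet> y) = 0"
      by (rule avg_square_eq_0[of "\<lambda>y. poly r (x \<bullet> y)"]) (rule that)
    then show ?thesis using that by (simp add: r_def)
  qed
  have "x \<bullet> x = 1" using xy norm_C by (simp add: norm_eq_1[symmetric])
  \<comment> \<open>Evaluation on the diagonal determines \<open>a\<close>, as \<open>P k\<close>
    has value 1 at 1.\<close>
  then have "a = poly h (x \<bullet> x)"
    using eq[of x x 1] xy by (simp add: gegenbauer_1[OF n])
  also have "\<dots> = avg (\<lambda>z. poly (P k * P k) (x \<bullet> z))"
    using h(2)[of x x] xy by (simp add: norm_C)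
  also have "\<dots> = mean (P k * P k)"
    using degree_mult_le[of "P k" "P k"] dk k xy by (intro avg_poly_inner) (auto simp: norm_C)
  also have "\<dots> = 1 / harmonic_dim n k"
    by (rule mean_gegenbauer_square[OF k])
  finally show ?thesis
    using h(2)[of x y] eq[of x y "x \<bullet> y"] xy by (simp add: norm_C)
qed

lemma avg_gegenbauer:
  assumes "2 * k \<le> t" "2 * l \<le> t" "x \<in> C" "y \<in> C"
  shows "avg (\<lambda>z. poly (P k) (x \<bullet> z) * poly (P l) (y \<bullet> z))
     = (if k = l then poly (P k) (x \<bullet> y) / harmonic_dim n k else 0)"
proof -
  have "degree (P k) \<le> k" "degree (P l) \<le> l"
    by (rule degree_gegenbauer_le)+
  consider "k = l" | "l < k" | "k < l" by linarith
  then show ?thesis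
  proof cases
    case 1
    then show ?thesis using avg_gegenbauer_same assms by simp
  next
    case 2
    then show ?thesis
      using avg_gegenbauer_orthogonal[of "P l" k x y] assms \<open>degree (P l) \<le> l\<close> by simp
  next
    case 3
    then show ?thesis
      using avg_gegenbauer_orthogonal[of "P k" l y x] assms \<open>degree (P k) \<le> k\<close>
      by (simp add: mult.commute)
  qed
qed

end

section \<open>Interpolation, unit vectors and a rationality criterion\<close>

lemma poly_interpolation:
  fixes f :: "real \<Rightarrow> real"
  assumes "finite A"
  obtains p where "degree p \<le> card A - 1" "\<And>a. a \<in> A \<Longrightarrow> poly p a = f a"
proof -
  \<comment> \<open>The Lagrange basis polynomials.\<close>
  define l where "l a = (\<Prod>b\<in>A - {a}. smult (1 / (a - b)) [:- b, 1:])" for a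
  have deg: "degree (l a) \<le> card A - 1" if "a \<in> A" for a
  proof -
    have "degree (l a) \<le> (\<Sum>b\<in>A - {a}. degree (smult (1 / (a - b)) [:- b, 1:]))"
      unfolding l_def
      using degree_prod_sum_le[of "A - {a}" "\<lambda>b. smult (1 / (a - b)) [:- b, 1:]"] assms
      unfolding o_def by blast
    also have "\<dots> \<le> (\<Sum>b\<in>A - {a}. 1)"
      by (intro sum_mono) simp
    finally show ?thesis using that assms by simp
  qed
  have val: "poly (l a) c = (if c = a then 1 else 0)" if "a \<in> A" "c \<in> A" for a c
  proof (cases "c = a")
    case True
    then have "poly (l a) c = (\<Prod>b\<in>A - {a}. 1)"
      unfolding l_def poly_prod by (intro prod.cong refl) (simp flip: diff_divide_distrib)
    then show ?thesis using True by simp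
  next
    case False
    then show ?thesis using that assms by (auto simp: l_def poly_prod)
  qed
  show thesis
  proof
    show "degree (\<Sum>a\<in>A. smult (f a) (l a)) \<le> card A - 1"
    proof (intro degree_sum_le assms)
      fix a assume "a \<in> A"
      then show "degree (smult (f a) (l a)) \<le> card A - 1"
        using deg degree_smult_le le_trans by blast
    qed
    fix c assume c: "c \<in> A"
    then have "poly (\<Sum>a\<in>A. smult (f a) (l a)) c = (\<Sum>a\<in>A. if a = c then f a else 0)"
      unfolding poly_sum by (intro sum.cong refl) (auto simp: val)
    then show "poly (\<Sum>a\<in>A. smult (f a) (l a)) c = f c"
      using c assms by simp
  qed
qed

lemma unit_inner_eq_1_iff:
  fixes x y :: "'a::real_inner"
  assumes "norm x = 1" "norm y = 1"
  shows "x \<bullet> y = 1 \<longleftrightarrow> x = y"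
proof -
  have "x \<bullet> x = 1" "y \<bullet> y = 1" using assms by (simp_all add: norm_eq_1)
  then have "(x - y) \<bullet> (x - y) = 2 - 2 * (x \<bullet> y)"
    by (simp add: inner_diff inner_commute[of y x])
  then have "x \<bullet> y = 1 \<longleftrightarrow> (x - y) \<bullet> (x - y) = 0" by linarith
  then show ?thesis by simp
qed

lemma Rats_mult_cancel_irrational:
  fixes a u :: real
  assumes "a \<in> \<rat>" "u * a \<in> \<rat>" "u \<notin> \<rat>"
  shows "a = 0"
proof (rule ccontr)
  assume "a \<noteq> 0"
  then have "u = u * a / a" by simp
  then show False using assms Rats_divide by metis
qed

text \<open>The value of polynomial 2 makes \<open>u\<^sup>2\<close> rational, and the values of 3
  and 5 are \<open>u\<close> times a rational. For irrational \<open>u\<close> both cofactors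
  vanish, giving \<open>(n + 2) * u\<^sup>2 = 3\<close> and \<open>n * u\<^sup>2 = 1\<close>, hence
  \<open>u\<^sup>2 = 1\<close> and \<open>n = 1\<close>.\<close>

lemma Rats_of_gegenbauer_2_3_5:
  assumes n: "n > 2" "n \<in> \<rat>"
    and rat: "poly (gegenbauer n 2) u \<in> \<rat>" "poly (gegenbauer n 3) u \<in> \<rat>" "poly (gegenbauer n 5) u \<in> \<rat>"
  shows "u \<in> \<rat>"
proof (rule ccontr)
  assume u: "u \<notin> \<rat>"
  have p2: "poly (gegenbauer n 2) u = (n * u\<^sup>2 - 1) / (n - 1)"
    by (simp add: numeral_2_eq_2 power2_eq_square diff_divide_distrib ac_simps)
  have "u\<^sup>2 = ((n - 1) * poly (gegenbauer n 2) u + 1) / n"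
    using n(1) by (simp add: p2)
  then have uu: "u\<^sup>2 \<in> \<rat>" using rat(1) n(2) by simp
  have p3': "poly (gegenbauer n 3) u = ((2 + n) * (u * poly (gegenbauer n 2) u) - 2 * u) / n"
    using gegenbauer.simps(3)[of n 1] n(1) by (simp add: eval_nat_numeral field_simps del: gegenbauer.simps(3))
  have p3: "poly (gegenbauer n 3) u = u * (((n + 2) * u\<^sup>2 - 3) / (n - 1))"
    unfolding p3' p2 using n(1) by (simp add: divide_simps) (simp add: algebra_simps)
  have "((n + 2) * u\<^sup>2 - 3) / (n - 1) \<in> \<rat>"
    using uu n(2) by simp
  with rat(2) u have z3: "((n + 2) * u\<^sup>2 - 3) / (n - 1) = 0"
    unfolding p3 by (metis Rats_mult_cancel_irrational)
  have p4: "poly (gegenbauer n 4) u = ((4 + n) * (u * poly (gegenbauer n 3) u) - 3 * poly (gegenbauer n 2) u) / (n + 1)"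
    using gegenbauer.simps(3)[of n 2] by (simp add: eval_nat_numeral add.commute[of n] del: gegenbauer.simps)
  have p5: "poly (gegenbauer n 5) u = ((6 + n) * (u * poly (gegenbauer n 4) u) - 4 * poly (gegenbauer n 3) u) / (n + 2)"
    using gegenbauer.simps(3)[of n 3] by (simp add: eval_nat_numeral add.commute[of n] del: gegenbauer.simps)
  \<comment> \<open>As the value of polynomial 3 is zero, the recursion reduces those of 4 and 5 to
    multiples of that of 2.\<close>
  have "poly (gegenbauer n 5) u = u * (- 3 * (6 + n) / ((n + 1) * (n + 2)) * poly (gegenbauer n 2) u)"
    unfolding p5 p4 p3 z3 using n(1) by (simp add: divide_simps) (simp add: algebra_simps)
  moreover have "- 3 * (6 + n) / ((n + 1) * (n + 2)) * poly (gegenbauer n 2) u \<in> \<rat>"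
    using rat(1) n(2) by simp
  ultimately have "- 3 * (6 + n) / ((n + 1) * (n + 2)) * poly (gegenbauer n 2) u = 0"
    using rat(3) u by (metis Rats_mult_cancel_irrational)
  then have "n * u\<^sup>2 = 1" using n(1) by (simp add: p2)
  moreover have "n * u\<^sup>2 + 2 * u\<^sup>2 = 3" using z3 n(1) by (simp add: algebra_simps)
  ultimately have "u\<^sup>2 = 1" by linarith
  then show False using \<open>n * u\<^sup>2 = 1\<close> n(1) by simp
qed

section \<open>Inner products and valencies\<close>

locale s_distance_design = spatial_design C t n for C :: "(real^'n) set" and t n +
  fixes s :: nat
  assumes s_distance: "s_distance s C" and t: "t \<ge> 2 * s - 2" and s: "s \<ge> 2"
begin

abbreviation N :: real
  where "N \<equiv> real (card C)"

definition vals :: "real set"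
  where "vals = insert 1 (inner_products C)"

lemma finite_inner_products: "finite (inner_products C)"
  and card_inner_products: "card (inner_products C) = s"
  using s_distance by (auto simp: s_distance_def)

lemma inner_eq_1_iff: "x \<in> C \<Longrightarrow> y \<in> C \<Longrightarrow> x \<bullet> y = 1 \<longleftrightarrow> x = y"
  by (simp add: unit_inner_eq_1_iff norm_C)

lemma inner_self: "x \<in> C \<Longrightarrow> x \<bullet> x = 1"
  by (simp add: inner_eq_1_iff)

lemma one_notin_inner_products: "1 \<notin> inner_products C"
  by (auto simp: inner_products_def inner_eq_1_iff dest: sym)

lemma finite_vals: "finite vals"
  by (simp add: vals_def finite_inner_products)

lemma card_vals: "card vals = Suc s"
  by (simp add: vals_def finite_inner_products card_inner_products one_notin_inner_products)

lemma inner_in_vals: "x \<in> C \<Longrightarrow> y \<in> C \<Longrightarrow> x \<bullet> y \<in> vals"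
  by (cases "x = y") (auto simp: vals_def inner_self inner_products_def)

lemma valsE:
  assumes "a \<in> vals"
  obtains x y where "x \<in> C" "y \<in> C" "a = x \<bullet> y"
proof -
  obtain x0 where "x0 \<in> C" using nonempty by blast
  then have "1 = x0 \<bullet> x0" by (simp add: inner_self)
  then show thesis
    using assms that \<open>x0 \<in> C\<close> unfolding vals_def inner_products_def by blast
qed

text \<open>The indicator of \<open>a\<close> on \<open>vals\<close> is interpolated by a polynomial
  of degree at most \<open>s\<close>. Since \<open>s \<le> 2 * s - 2 \<le> t\<close>, its average
  does not depend on the point.\<close>

lemma card_inner_const:
  assumes "x \<in> C" "y \<in> C" "a \<in> vals"
  shows "card {z \<in> C. x \<bullet> z = a} = card {z \<in> C. y \<bullet> z = a}"
proof -
  obtain p where p: "degree p \<le> card vals - 1" "\<And>b. b \<in> vals \<Longrightarrow> poly p b = (if b = a then 1 else 0)"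
    using poly_interpolation[OF finite_vals, of "\<lambda>b. if b = a then 1 else 0"] by blast
  have mean: "real (card {z \<in> C. x \<bullet> z = a}) = N * mean p" if x: "x \<in> C" for x
  proof -
    have "mean p = avg (\<lambda>z. poly p (x \<bullet> z))"
      using p(1) t s x by (simp add: avg_poly_inner norm_C card_vals)
    also have "\<dots> = avg (\<lambda>z. if x \<bullet> z = a then 1 else 0)"
      using x inner_in_vals by (intro avg_cong) (simp add: p(2))
    also have "\<dots> = real (card {z \<in> C. x \<bullet> z = a}) / N"
      using finite_C by (simp add: avg_def sum.If_cases Int_def)
    finally show ?thesis using card_C_pos by simp
  qed
  show ?thesis using mean[OF assms(1)] mean[OF assms(2)] by simp
qed

definition valency :: "real \<Rightarrow> nat"
  where "valency a = card {z \<in> C. (SOME x. x \<in> C) \<bullet> z = a}"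

lemma valency_eq: "x \<in> C \<Longrightarrow> a \<in> vals \<Longrightarrow> card {z \<in> C. x \<bullet> z = a} = valency a"
  unfolding valency_def by (rule card_inner_const) (auto intro: someI)

lemma valency_pos:
  assumes "a \<in> vals"
  shows "valency a > 0"
proof -
  obtain x y where "x \<in> C" "y \<in> C" "a = x \<bullet> y"
    using assms by (rule valsE)
  then have "y \<in> {z \<in> C. x \<bullet> z = a}" by simp
  then have "card {z \<in> C. x \<bullet> z = a} > 0"
    using finite_C by (auto simp: card_gt_0_iff)
  then show ?thesis using valency_eq[OF \<open>x \<in> C\<close> assms] by simp
qed

lemma avg_indicator_inner:
  fixes f :: "real \<Rightarrow> real"
  assumes "x \<in> C" "b \<in> vals"
  shows "avg (\<lambda>z. (if x \<bullet> z = b then 1 else 0) * f (x \<bullet> z)) = valency b * f b / N"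
proof -
  have "(\<Sum>z\<in>C. (if x \<bullet> z = b then 1 else 0) * f (x \<bullet> z)) = (\<Sum>z\<in>{z \<in> C. x \<bullet> z = b}. f b)"
    using finite_C by (intro sum.mono_neutral_cong_right) auto
  then show ?thesis
    by (simp add: avg_def valency_eq[OF assms])
qed

section \<open>The orthogonal idempotents\<close>

text \<open>For \<open>k < s\<close>, \<open>proj k (x \<bullet> y)\<close> is the reproducing kernel of the harmonic polynomials of
  degree \<open>k\<close> restricted to \<open>C\<close>; \<open>proj s\<close> is the kernel of the orthogonal complement.\<close>

definition proj :: "nat \<Rightarrow> real \<Rightarrow> real"
  where "proj k a = (if k < s then harmonic_dim n k * poly (P k) a
    else (if a = 1 then N else 0) - (\<Sum>j<s. harmonic_dim n j * poly (P j) a))"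

text \<open>The idempotents add up to the identity, whose kernel has \<open>N\<close> on the
  diagonal because \<open>avg\<close> divides by \<open>N\<close>.\<close>

lemma sum_proj: "(\<Sum>k\<le>s. proj k a) = (if a = 1 then N else 0)"
proof -
  have "(\<Sum>k<s. proj k a) = (\<Sum>j<s. harmonic_dim n j * poly (P j) a)"
    by (intro sum.cong refl) (simp add: proj_def)
  then show ?thesis by (simp add: proj_def flip: lessThan_Suc_atMost)
qed

lemma proj_s: "proj s a = (if a = 1 then N else 0) - (\<Sum>k<s. proj k a)"
  using sum_proj[of a] by (simp flip: lessThan_Suc_atMost)

lemma avg_diagonal:
  assumes "x \<in> C"
  shows "avg (\<lambda>z. (if x \<bullet> z = 1 then N else 0) * f z) = f x"
proof -
  have "(\<Sum>z\<in>C. (if x \<bullet> z = 1 then N else 0) * f z) = (\<Sum>z\<in>C. if z = x then N * f z else 0)"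
    using assms by (intro sum.cong refl) (auto simp: inner_eq_1_iff inner_self)
  then show ?thesis
    using assms finite_C nonempty by (simp add: avg_def)
qed

lemma avg_proj_less:
  assumes "k < s" "l < s" "x \<in> C" "y \<in> C"
  shows "avg (\<lambda>z. proj k (x \<bullet> z) * proj l (y \<bullet> z)) = (if k = l then proj k (x \<bullet> y) else 0)"
proof -
  \<comment> \<open>From \<open>k \<le> s - 1\<close> one gets \<open>2 * k \<le> 2 * s - 2\<close>,
    exactly the assumed bound on \<open>t\<close>.\<close>
  have "2 * k \<le> t" "2 * l \<le> t" using assms t by linarith+
  then have "avg (\<lambda>z. (harmonic_dim n k * harmonic_dim n l) * (poly (P k) (x \<bullet> z) * poly (P l) (y \<bullet> z)))
    = (if k = l then harmonic_dim n k * poly (P k) (x \<bullet> y) else 0)"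
    unfolding avg_cmult using assms harmonic_dim_pos[OF n, of k] by (simp add: avg_gegenbauer)
  then show ?thesis
    using assms by (simp add: proj_def ac_simps)
qed

lemma avg_proj_s:
  assumes "k < s" "x \<in> C" "y \<in> C"
  shows "avg (\<lambda>z. proj k (x \<bullet> z) * proj s (y \<bullet> z)) = 0"
proof -
  have "avg (\<lambda>z. proj k (x \<bullet> z) * proj s (y \<bullet> z))
    = avg (\<lambda>z. (if y \<bullet> z = 1 then N else 0) * proj k (x \<bullet> z) - (\<Sum>l<s. proj k (x \<bullet> z) * proj l (y \<bullet> z)))"
    unfolding proj_s by (simp only: right_diff_distrib sum_distrib_left mult.commute)
  also have "\<dots> = proj k (x \<bullet> y) - (\<Sum>l<s. if k = l then proj k (x \<bullet> y) else 0)"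
    unfolding avg_diff avg_sum avg_diagonal[OF assms(3)] using assms by (simp add: avg_proj_less)
  also have "\<dots> = 0" using assms by simp
  finally show ?thesis .
qed

text \<open>With \<open>avg\<close> as matrix product, the new case is the square of
  \<open>proj s\<close>: the identity minus the other idempotents fixes \<open>proj s\<close>, since
  they annihilate it.\<close>

lemma avg_proj:
  assumes "k \<le> s" "l \<le> s" "x \<in> C" "y \<in> C"
  shows "avg (\<lambda>z. proj k (x \<bullet> z) * proj l (y \<bullet> z)) = (if k = l then proj k (x \<bullet> y) else 0)"
proof -
  have "avg (\<lambda>z. proj s (x \<bullet> z) * proj s (y \<bullet> z))
    = avg (\<lambda>z. (if x \<bullet> z = 1 then N else 0) * proj s (y \<bullet> z) - (\<Sum>l<s. proj l (x \<bullet> z) * proj s (y \<bullet> z)))"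
    by (subst (1) proj_s) (simp only: left_diff_distrib sum_distrib_right)
  also have "\<dots> = proj s (x \<bullet> y)"
    unfolding avg_diff avg_sum avg_diagonal[OF assms(3)]
    using assms by (simp add: avg_proj_s inner_commute[of y x])
  finally have ss: "avg (\<lambda>z. proj s (x \<bullet> z) * proj s (y \<bullet> z)) = proj s (x \<bullet> y)" .
  have sl: "avg (\<lambda>z. proj s (x \<bullet> z) * proj l (y \<bullet> z)) = 0" if "l < s"
    using avg_proj_s[OF that assms(4,3)] by (simp only: mult.commute)
  consider "k < s" "l < s" | "k < s" "l = s" | "k = s" "l < s" | "k = s" "l = s"
    using assms by linarith
  then show ?thesis
    by cases (use assms in \<open>simp_all add: avg_proj_less avg_proj_s sl ss\<close>)
qed

text \<open>The constant diagonal entry of \<open>proj k (x \<bullet> y)\<close>, hence the trace of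
  the idempotent obtained on division by \<open>N\<close>.\<close>

definition eig_dim :: "nat \<Rightarrow> real"
  where "eig_dim k = proj k 1"

lemma eig_dim_less: "k < s \<Longrightarrow> eig_dim k = harmonic_dim n k"
  by (simp add: eig_dim_def proj_def gegenbauer_1[OF n])

lemma n_Rats: "n \<in> \<rat>"
  by (simp add: n_eq)

lemma eig_dim_Rats: "eig_dim k \<in> \<rat>"
  by (simp add: eig_dim_def proj_def gegenbauer_1[OF n] harmonic_dim_Rats n_Rats Rats_sum)

text \<open>For \<open>k = s\<close> this is an average of squares. Were it zero,
  \<open>proj s\<close> would vanish on all inner products, and the polynomial \<open>q\<close> of
  degree at most \<open>s - 1\<close> would have \<open>s\<close> roots although it is positive at
  1.\<close>

lemma eig_dim_pos:
  assumes "k \<le> s"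
  shows "eig_dim k > 0"
proof (cases "k < s")
  case True
  then show ?thesis by (simp add: eig_dim_less harmonic_dim_pos[OF n])
next
  case False
  then have k: "k = s" using assms by simp
  have sq: "eig_dim s = avg (\<lambda>z. proj s (x \<bullet> z) * proj s (x \<bullet> z))" if "x \<in> C" for x
    using avg_proj[of s s x x] that by (simp add: eig_dim_def inner_self)
  obtain x where "x \<in> C" using nonempty by blast
  have "eig_dim s \<ge> 0"
    unfolding sq[OF \<open>x \<in> C\<close>] avg_def by (intro divide_nonneg_nonneg sum_nonneg) auto
  moreover have "eig_dim s \<noteq> 0"
  proof
    assume "eig_dim s = 0"
    then have zero: "proj s (x \<bullet> y) = 0" if "x \<in> C" "y \<in> C" for x y
      using avg_square_eq_0[of "\<lambda>z. proj s (x \<bullet> z)" y] sq[of x] that by simp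
    define q where "q = (\<Sum>j<s. smult (harmonic_dim n j) (P j))"
    have "poly q a = 0" if "a \<in> inner_products C" for a
    proof -
      have "proj s a = 0" using that zero by (auto simp: inner_products_def)
      moreover have "a \<noteq> 1" using that one_notin_inner_products by blast
      ultimately show ?thesis by (simp add: proj_def q_def poly_sum)
    qed
    then have sub: "inner_products C \<subseteq> {a. poly q a = 0}" by auto
    have "poly q 1 = (\<Sum>j<s. harmonic_dim n j)"
      by (simp add: q_def poly_sum gegenbauer_1[OF n])
    also have "\<dots> > 0"
      using s by (intro sum_pos) (auto simp: harmonic_dim_pos[OF n] lessThan_empty_iff)
    finally have "q \<noteq> 0" by auto
    then have "s \<le> card {a. poly q a = 0}"
      using card_mono[OF poly_roots_finite sub] by (simp add: card_inner_products)
    also have "\<dots> \<le> degree q" by (rule card_poly_roots_bound[OF \<open>q \<noteq> 0\<close>])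
    also have "degree q \<le> s - 1"
      unfolding q_def
    proof (intro degree_sum_le)
      fix j assume "j \<in> {..<s}"
      then show "degree (smult (harmonic_dim n j) (P j)) \<le> s - 1"
        using degree_gegenbauer_le[of n j] degree_smult_le[of "harmonic_dim n j" "P j"] by simp
    qed simp
    finally show False using s by simp
  qed
  ultimately show ?thesis by (simp add: k)
qed

text \<open>Interpolate \<open>f\<close> at the \<open>s\<close> inner products and expand in
  Gegenbauer polynomials. The value at 1 is then corrected by a multiple of the sum of all
  \<open>proj k\<close>, which is \<open>N\<close> at 1 and zero elsewhere.\<close>

lemma proj_span:
  obtains e where "\<And>a. a \<in> vals \<Longrightarrow> f a = (\<Sum>k\<le>s. e k * proj k a)"
proof -
  obtain p where p: "degree p \<le> card (inner_products C) - 1" "\<And>a. a \<in> inner_products C \<Longrightarrow> poly p a = f a"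
    using poly_interpolation[OF finite_inner_products] by blast
  have "\<exists>c. p = (\<Sum>k\<le>s - 1. smult (c k) (P k))"
    using p(1) by (intro gegenbauer_span[OF n]) (simp add: card_inner_products)
  then obtain c where "p = (\<Sum>k\<le>s - 1. smult (c k) (P k))" by blast
  moreover have "{..s - 1} = {..<s}" using s by auto
  ultimately have c: "p = (\<Sum>k<s. smult (c k) (P k))" by simp
  define d where "d = (f 1 - poly p 1) / N"
  define e where "e k = (if k < s then c k / harmonic_dim n k else 0) + d" for k
  show thesis
  proof
    fix a assume a: "a \<in> vals"
    have "(\<Sum>k\<le>s. e k * proj k a)
        = (\<Sum>k\<le>s. (if k < s then c k / harmonic_dim n k else 0) * proj k a) + d * (\<Sum>k\<le>s. proj k a)"
      by (simp add: e_def algebra_simps sum.distrib sum_distrib_left)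
    also have "(\<Sum>k\<le>s. (if k < s then c k / harmonic_dim n k else 0) * proj k a) = (\<Sum>k<s. c k * poly (P k) a)"
      using harmonic_dim_pos[OF n]
      by (auto simp: proj_def less_imp_neq[symmetric] simp flip: lessThan_Suc_atMost intro!: sum.cong)
    also have "\<dots> = poly p a" by (simp add: c poly_sum)
    also have "poly p a + d * (\<Sum>k\<le>s. proj k a) = f a"
      using a p(2) one_notin_inner_products card_C_pos
      by (auto simp: sum_proj vals_def d_def)
    finally show "f a = (\<Sum>k\<le>s. e k * proj k a)" ..
  qed
qed

text \<open>The second orthogonality relation, as for character tables: expand the indicator of
  \<open>b\<close> in the \<open>proj k\<close> and compute the coefficients by pairing with
  \<open>proj k\<close>.\<close>

lemma proj_dual_orthogonal:
  assumes a: "a \<in> vals" and b: "b \<in> vals"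
  shows "(\<Sum>k\<le>s. proj k a * proj k b / eig_dim k) = (if a = b then N / valency b else 0)"
proof -
  obtain e where e: "\<And>a. a \<in> vals \<Longrightarrow> (if a = b then 1 else 0) = (\<Sum>k\<le>s. e k * proj k a)"
    using proj_span[of "\<lambda>a. if a = b then 1 else 0"] by blast
  obtain x where x: "x \<in> C" using nonempty by blast
  have ek: "valency b * proj k b / N = e k * eig_dim k" if k: "k \<le> s" for k
  proof -
    have "valency b * proj k b / N = avg (\<lambda>z. (if x \<bullet> z = b then 1 else 0) * proj k (x \<bullet> z))"
      by (rule avg_indicator_inner[OF x b, symmetric])
    also have "\<dots> = avg (\<lambda>z. \<Sum>l\<le>s. e l * (proj l (x \<bullet> z) * proj k (x \<bullet> z)))"
      using x inner_in_vals by (intro avg_cong) (simp add: e sum_distrib_right mult.assoc)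
    also have "\<dots> = (\<Sum>l\<le>s. e l * (if l = k then proj l (x \<bullet> x) else 0))"
      unfolding avg_sum avg_cmult using x k by (simp add: avg_proj)
    also have "\<dots> = e k * eig_dim k"
      using k x by (simp add: if_distrib[of "\<lambda>u. _ * u"] inner_self eig_dim_def cong: if_cong)
    finally show ?thesis .
  qed
  have vb: "real (valency b) > 0" using valency_pos[OF b] by simp
  have "proj k a * proj k b / eig_dim k = N / valency b * (e k * proj k a)" if "k \<le> s" for k
    using ek[OF that] eig_dim_pos[OF that] vb card_C_pos by (simp add: field_simps)
  then have "(\<Sum>k\<le>s. proj k a * proj k b / eig_dim k) = N / valency b * (\<Sum>k\<le>s. e k * proj k a)"
    by (simp add: sum_distrib_left)
  then show ?thesis
    unfolding e[OF a, symmetric] by simp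
qed

section \<open>Rationality of the idempotents and of the inner products\<close>

text \<open>The right-hand side is visibly rational, while the left-hand side is the spectral
  decomposition of a matrix with eigenvalues \<open>1 / eig_dim k\<close>.\<close>

lemma sum_proj_div_eig_dim:
  assumes "x \<in> C" "y \<in> C"
  shows "(\<Sum>k\<le>s. proj k (x \<bullet> y) / eig_dim k) = (\<Sum>z\<in>C. if x \<bullet> z = y \<bullet> z then 1 / valency (y \<bullet> z) else 0)"
proof -
  have "(\<Sum>k\<le>s. proj k (x \<bullet> y) / eig_dim k)
      = (\<Sum>k\<le>s. 1 / eig_dim k * avg (\<lambda>z. proj k (x \<bullet> z) * proj k (y \<bullet> z)))"
    using assms by (intro sum.cong refl) (simp add: avg_proj)
  also have "\<dots> = avg (\<lambda>z. \<Sum>k\<le>s. proj k (x \<bullet> z) * proj k (y \<bullet> z) / eig_dim k)"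
    by (simp add: avg_sum flip: avg_cmult)
  also have "\<dots> = avg (\<lambda>z. N * (if x \<bullet> z = y \<bullet> z then 1 / valency (y \<bullet> z) else 0))"
    using assms inner_in_vals by (intro avg_cong) (simp add: proj_dual_orthogonal)
  also have "\<dots> = (\<Sum>z\<in>C. if x \<bullet> z = y \<bullet> z then 1 / valency (y \<bullet> z) else 0)"
    unfolding avg_cmult using card_C_pos by (simp add: avg_def)
  finally show ?thesis .
qed

text \<open>Let \<open>M\<close> be the rational matrix with eigenvalues
  \<open>1 / eig_dim k\<close> on the idempotents. The sum represents, up to the factor
  \<open>N\<close>, the product of the \<open>M - \<mu>\<close>, and rational matrices are closed
  under products.\<close>

lemma sum_proj_prod_Rats:
  assumes "finite S" "S \<subseteq> \<rat>"
  shows "x \<in> C \<Longrightarrow> y \<in> C \<Longrightarrow> (\<Sum>k\<le>s. proj k (x \<bullet> y) * (\<Prod>\<mu>\<in>S. 1 / eig_dim k - \<mu>)) \<in> \<rat>"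
  using assms
proof (induction S arbitrary: x y)
  case empty
  then show ?case by (simp add: sum_proj)
next
  case (insert \<nu> S)
  define b where "b k = (\<Prod>\<mu>\<in>S. 1 / eig_dim k - \<mu>)" for k
  have IH: "(\<Sum>k\<le>s. proj k (x \<bullet> y) * b k) \<in> \<rat>" if "x \<in> C" "y \<in> C" for x y
    using insert that by (simp add: b_def)
  have kernel: "(\<Sum>k\<le>s. proj k (x \<bullet> y) / eig_dim k) \<in> \<rat>" if "x \<in> C" "y \<in> C" for x y
    unfolding sum_proj_div_eig_dim[OF that] by (intro Rats_sum) auto
  have "avg (\<lambda>z. (\<Sum>k\<le>s. proj k (x \<bullet> z) * b k) * (\<Sum>l\<le>s. proj l (y \<bullet> z) / eig_dim l))
      = avg (\<lambda>z. \<Sum>k\<le>s. \<Sum>l\<le>s. (b k / eig_dim l) * (proj k (x \<bullet> z) * proj l (y \<bullet> z)))"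
    unfolding sum_product by (simp add: ac_simps)
  also have "\<dots> = (\<Sum>k\<le>s. \<Sum>l\<le>s. (b k / eig_dim l) * (if k = l then proj k (x \<bullet> y) else 0))"
    unfolding avg_sum avg_cmult using insert.prems by (simp add: avg_proj)
  also have "\<dots> = (\<Sum>k\<le>s. proj k (x \<bullet> y) * b k * (1 / eig_dim k))"
    by (simp add: if_distrib[of "\<lambda>u. _ * u"] ac_simps cong: if_cong)
  finally have eq: "(\<Sum>k\<le>s. proj k (x \<bullet> y) * b k * (1 / eig_dim k))
      = avg (\<lambda>z. (\<Sum>k\<le>s. proj k (x \<bullet> z) * b k) * (\<Sum>l\<le>s. proj l (y \<bullet> z) / eig_dim l))" ..
  have "(\<Sum>k\<le>s. proj k (x \<bullet> y) * b k * (1 / eig_dim k)) \<in> \<rat>"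
    unfolding eq avg_def
    by (intro Rats_divide[OF Rats_sum Rats_of_nat] Rats_mult[OF IH kernel] insert.prems)
  moreover have "(\<Sum>k\<le>s. proj k (x \<bullet> y) * (\<Prod>\<mu>\<in>insert \<nu> S. 1 / eig_dim k - \<mu>))
      = (\<Sum>k\<le>s. proj k (x \<bullet> y) * b k * (1 / eig_dim k)) - \<nu> * (\<Sum>k\<le>s. proj k (x \<bullet> y) * b k)"
    using insert.hyps
    by (simp add: b_def algebra_simps sum_subtractf sum_distrib_left)
  ultimately show ?case
    using IH insert.prems by simp
qed

text \<open>The eigenvalue of index \<open>i\<close> is simple, so the product over all other
  eigenvalues annihilates every other idempotent and multiplies \<open>proj i\<close> by a nonzero
  rational \<open>c\<close>.\<close>

lemma proj_Rats:
  assumes i: "i < s" "eig_dim i \<noteq> eig_dim s" and xy: "x \<in> C" "y \<in> C"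
  shows "proj i (x \<bullet> y) \<in> \<rat>"
proof -
  \<comment> \<open>An image set, so coincidences among the other eigenvalues do no harm.\<close>
  define S where "S = (\<lambda>k. 1 / eig_dim k) ` ({..s} - {i})"
  have inj: "eig_dim k \<noteq> eig_dim i" if "k \<le> s" "k \<noteq> i" for k
  proof (cases "k < s")
    case True
    then show ?thesis
      using i(1) that strict_mono_eq[OF harmonic_dim_strict_mono[OF n]] by (simp add: eig_dim_less)
  next
    case False
    then show ?thesis using i(2) that by (metis le_neq_implies_less)
  qed
  define c where "c = (\<Prod>\<mu>\<in>S. 1 / eig_dim i - \<mu>)"
  have S: "finite S" "S \<subseteq> \<rat>"
    using eig_dim_Rats by (auto simp: S_def)
  have "c \<noteq> 0"
  proof
    assume "c = 0"
    then have "1 / eig_dim i \<in> S"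
      using S(1) by (simp add: c_def)
    then obtain k where "k \<le> s" "k \<noteq> i" "1 / eig_dim i = 1 / eig_dim k"
      unfolding S_def by blast
    then show False using inj[of k] by simp
  qed
  have "c \<in> \<rat>"
    unfolding c_def using S(2) eig_dim_Rats by (intro Rats_prod) auto
  have "(\<Prod>\<mu>\<in>S. 1 / eig_dim k - \<mu>) = 0" if "k \<le> s" "k \<noteq> i" for k
    using S(1) that by (auto simp: S_def)
  then have "(\<Sum>k\<le>s. proj k (x \<bullet> y) * (\<Prod>\<mu>\<in>S. 1 / eig_dim k - \<mu>)) = (\<Sum>k\<le>s. if k = i then proj i (x \<bullet> y) * c else 0)"
    by (intro sum.cong refl) (auto simp: c_def)
  also have "\<dots> = proj i (x \<bullet> y) * c" using i(1) by simp
  finally have "proj i (x \<bullet> y) * c \<in> \<rat>"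
    using sum_proj_prod_Rats[OF S xy] by simp
  then have "proj i (x \<bullet> y) * c / c \<in> \<rat>"
    using \<open>c \<in> \<rat>\<close> by (rule Rats_divide)
  then show ?thesis using \<open>c \<noteq> 0\<close> by simp
qed

lemma poly_gegenbauer_Rats:
  assumes "i < s" "eig_dim i \<noteq> eig_dim s" "x \<in> C" "y \<in> C"
  shows "poly (P i) (x \<bullet> y) \<in> \<rat>"
proof -
  have "harmonic_dim n i * poly (P i) (x \<bullet> y) / harmonic_dim n i \<in> \<rat>"
    using proj_Rats[OF assms] assms(1)
    by (intro Rats_divide harmonic_dim_Rats n_Rats) (simp add: proj_def)
  then show ?thesis using harmonic_dim_pos[OF n, of i] by simp
qed

text \<open>At most one of the multiplicities \<open>eig_dim k\<close> with \<open>k < s\<close> coincides with \<open>eig_dim s\<close>.\<close>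

lemma inner_Rats:
  assumes s5: "s > 5" and xy: "x \<in> C" "y \<in> C"
  shows "x \<bullet> y \<in> \<rat>"
proof (cases "eig_dim 1 = eig_dim s")
  case False
  then show ?thesis using poly_gegenbauer_Rats[of 1 x y] s5 xy by simp
next
  case True
  \<comment> \<open>Here \<open>eig_dim s\<close> equals \<open>harmonic_dim n 1\<close>, which lies
    strictly below \<open>harmonic_dim n k\<close> for \<open>k > 1\<close>.\<close>
  have rat: "poly (P k) (x \<bullet> y) \<in> \<rat>" if "1 < k" "k < s" for k
  proof (rule poly_gegenbauer_Rats[OF that(2) _ xy])
    show "eig_dim k \<noteq> eig_dim s"
      using strict_monoD[OF harmonic_dim_strict_mono[OF n] that(1)] that eig_dim_less[of k] eig_dim_less[of 1] True
      by simp
  qed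
  show ?thesis
    by (rule Rats_of_gegenbauer_2_3_5[OF n n_Rats rat rat rat]) (use s5 in simp_all)
qed

end

theorem theorem2p6:
  fixes C :: "(real ^ 'n) set" and s t :: nat
  assumes "s > 5" and "CARD('n) > 2"
    and "spherical_design t C" and "s_distance s C"
    and "t \<ge> 2 * s - 2"
  shows "\<forall>x\<in>C. \<forall>y\<in>C. x \<bullet> y \<in> \<rat>"
proof (intro ballI)
  fix x y assume xy: "x \<in> C" "y \<in> C"
  interpret s_distance_design C t "real CARD('n)" s
  proof unfold_locales
    show "C \<noteq> {}" using xy by blast
    show "s \<ge> 2" using assms(1) by simp
    show "real CARD('n) > 2" using assms(2) by simp
  qed (use assms in simp_all)
  show "x \<bullet> y \<in> \<rat>" using assms(1) xy by (rule inner_Rats)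
qed

end
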